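(* In the setting described in the context ($\sigma^2$ unknown, no candidate model correct), suppose that, with $\lambda_n=\log\frac{n}{n-k}$: (i) $\displaystyle\sum_{\alpha\in\mathcal A_n}\frac{1}{[nR_n(\alpha)]^m}\to 0$ for some positive integer $m$ for which $E(e_1^{4m})<\infty$; $\displaystyle\frac{p_n\lambda_n}{\min_{\alpha\in\mathcal A_n} nR_n(\alpha)}\to 0$; and $\displaystyle\max_{\alpha\in\mathcal A_n}\frac{\frac1r\sum_{i=1}^r a_{in}(\alpha)}{nR_n(\alpha)}\to 0$; (ii) $\displaystyle\liminf_{n\to\infty}\min_{\alpha\in\mathcal A_n}\Delta_n(\alpha)>0$; (iii) $\displaystyle\frac{n-k}{n}\log n\to0$, $\displaystyle\frac{p_n\lambda_n}{n}\to0$, and $\frac1n\sum_{j=1}^n\mu_j^2$ is bounded, where $\mu_1,\dots,\mu_n$ are the components of $\boldsymbol\mu$; (iv) $\displaystyle\frac{1}{nr}\sum_{i=1}^r a_{in}(\alpha)\to0$; (v) $\displaystyle\sum_{i=1}^r\log(S_i)>0$ with probability tending to $1$. Let $\hat\alpha_n\in\mathcal A_n$ be a minimizer of $\Gamma(\alpha)$ over $\mathcal A_n$, and let $\alpha_n^L\in\mathcal A_n$ be a minimizer of $L_n(\alpha)$ over $\mathcal A_n$. Then $$\frac{L_n(\hat\alpha_n)}{L_n(\alpha_n^L)}\to1\quad\text{in probability.}$$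
   Context: Data. For each $n$, $\mathbf y=\boldsymbol\mu+\mathbf e\in\mathbb R^n$, where $\boldsymbol\mu=\boldsymbol\mu_n\in\mathbb R^n$ is a fixed (unknown) mean vector and $\mathbf e=(e_1,\dots,e_n)'$ has independent components with mean $0$ and common variance $\sigma^2$. $X=X_n$ is a given $n\times p_n$ matrix. All limits are as $n\to\infty$; $p_n,k,r,\mathcal A_n,X,\boldsymbol\mu$ may depend on $n$. Models. $\mathcal A_n$ is a collection of nonempty subsets $\alpha\subset\{1,\dots,p_n\}$; $p_n(\alpha)=|\alpha|$ and $X(\alpha)$ is the $n\times p_n(\alpha)$ submatrix of $X$ with columns indexed by $\alpha$. Put $P(\alpha)=X(\alpha)(X'(\alpha)X(\alpha))^{-1}X'(\alpha)$, $\hat{\boldsymbol\beta}(\alpha)=(X'(\alpha)X(\alpha))^{-1}X'(\alpha)\mathbf y$. No model is correct: $\boldsymbol\mu$ is not in the column space of $X(\alpha)$ for any $\alpha\in\mathcal A_n$. Training samples. $1\le k<n$, $n-k\to\infty$. There are $r$ training samples, the $i$-th given by an index set $T_i\subset\{1,\dots,n\}$ with $|T_i|=n-k$; each index $j\in\{1,\dots,n\}$ belongs to the same number of the sets $T_1,\dots,T_r$. $\mathbf y_i$ is the subvector of $\mathbf y$ indexed by $T_i$, and $X_i(\alpha)$ is the submatrix of $X(\alpha)$ consisting of the rows indexed by $T_i$. $X_i'(\alpha)X_i(\alpha)$ is nonsingular for every $i$ and every $\alpha$, and $\hat{\boldsymbol\beta}_i(\alpha)=[X_i'(\alpha)X_i(\alpha)]^{-1}X_i'(\alpha)\mathbf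 y_i$. Loss and risk. $L_n(\alpha)=\frac1n\|\boldsymbol\mu-P(\alpha)\mathbf y\|^2$, $\Delta_n(\alpha)=\frac1n\boldsymbol\mu'(I-P(\alpha))\boldsymbol\mu$, $nR_n(\alpha)=E(nL_n(\alpha))=n\Delta_n(\alpha)+\sigma^2p_n(\alpha)$. Criterion ($\sigma^2$ unknown). Let $S(\alpha)=\|\mathbf y-X(\alpha)\hat{\boldsymbol\beta}(\alpha)\|^2$ and $S_i(\alpha)=\|\mathbf y_i-X_i(\alpha)\hat{\boldsymbol\beta}_i(\alpha)\|^2$. $S_i$ denotes $S_i(\alpha)$ for the full model $\alpha=\{1,\dots,p_n\}$. The criterion is $$\Gamma(\alpha)=\log[S(\alpha)]-\frac{n-k}{nr}\sum_{i=1}^r\log[S_i(\alpha)]+\frac1{nr}\sum_{i=1}^r\log\frac{|X'(\alpha)X(\alpha)|}{|X_i'(\alpha)X_i(\alpha)|},$$ where $|\cdot|$ of a matrix is its determinant. It arises from averaging over $i$ the log cross-validatory predictive densities of the observations outside $T_i$ given $\mathbf y_i$, under the model $\mathbf y\sim N(X(\alpha)\boldsymbol\beta(\alpha),\sigma^2I_n)$ with prior $\pi(\boldsymbol\beta(\alpha),\sigma^2)\propto1/\sigma^2$. Also $$a_{in}(\alpha)=\log\left\{\frac{(n-k)^{p_n(\alpha)}|X'(\alpha)X(\alpha)|}{n^{p_n(\alpha)}|X_i'(\alpha)X_i(\alpha)|}\right\}.$$ *)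

theory Defs
  imports
    "HOL-Probability.Probability"
    "Jordan_Normal_Form.Determinant"
    "Jordan_Normal_Form.DL_Submatrix"
    "Jordan_Normal_Form.Gauss_Jordan_Elimination"
    "Jordan_Normal_Form.VS_Connect"
begin

no_notation Finite_Cartesian_Product.vec_nth (infixl "$" 90)
hide_const (open) Finite_Cartesian_Product.vec Finite_Cartesian_Product.mat
  Finite_Cartesian_Product.transpose Determinants.det

text \<open>Observations and regressors are numbered from 0: rows of a design matrix are indexed by
  \<open>{..<n}\<close>, columns by \<open>{..<p}\<close>, and a model is a set of column indices. The
  submatrices \<open>X(\<alpha>)\<close> and \<open>X\<^sub>i(\<alpha>)\<close> are \<open>submatrix X UNIV \<alpha>\<close> and
  \<open>submatrix X (T i) \<alpha>\<close>.\<close>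

text \<open>Entries are listed in increasing order of their index, as for the rows in
  \<open>submatrix\<close>.\<close>
definition subvec :: "real vec \<Rightarrow> nat set \<Rightarrow> real vec" where
  "subvec v I = vec (card {i. i < dim_vec v \<and> i \<in> I}) (\<lambda>i. v $ pick I i)"

definition sqnorm :: "real vec \<Rightarrow> real" where
  "sqnorm v = scalar_prod v v"

definition gram :: "real mat \<Rightarrow> real mat" where
  "gram Z = transpose_mat Z * Z"

text \<open>\<open>mat_inverse\<close> returns \<open>None\<close> on singular matrices; the next three definitions are
  meaningful only for nonsingular \<open>gram Z\<close>.\<close>
definition proj :: "real mat \<Rightarrow> real mat" where
  "proj Z = Z * the (mat_inverse (gram Z)) * transpose_mat Z"

definition beta_hat :: "real mat \<Rightarrow> real vec \<Rightarrow> real vec" where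
  "beta_hat Z v = (the (mat_inverse (gram Z)) * transpose_mat Z) *\<^sub>v v"

definition rss :: "real mat \<Rightarrow> real vec \<Rightarrow> real" where
  "rss Z v = sqnorm (v - Z *\<^sub>v beta_hat Z v)"

definition obs :: "real vec \<Rightarrow> (nat \<Rightarrow> 'a \<Rightarrow> real) \<Rightarrow> 'a \<Rightarrow> real vec" where
  "obs \<mu> e \<omega> = \<mu> + vec (dim_vec \<mu>) (\<lambda>j. e j \<omega>)"

definition loss :: "real mat \<Rightarrow> real vec \<Rightarrow> real vec \<Rightarrow> nat set \<Rightarrow> real" where
  "loss X \<mu> y \<alpha> = sqnorm (\<mu> - proj (submatrix X UNIV \<alpha>) *\<^sub>v y) / real (dim_row X)"

definition Delta :: "real mat \<Rightarrow> real vec \<Rightarrow> nat set \<Rightarrow> real" where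
  "Delta X \<mu> \<alpha> =
     scalar_prod \<mu> ((1\<^sub>m (dim_row X) - proj (submatrix X UNIV \<alpha>)) *\<^sub>v \<mu>) / real (dim_row X)"

text \<open>\<open>n R\<^sub>n(\<alpha>) = E (n L\<^sub>n(\<alpha>))\<close>, the expectation being taken over the errors \<open>e\<close>.\<close>
definition nrisk ::
  "'a measure \<Rightarrow> (nat \<Rightarrow> 'a \<Rightarrow> real) \<Rightarrow> real mat \<Rightarrow> real vec \<Rightarrow> nat set \<Rightarrow> real" where
  "nrisk M e X \<mu> \<alpha> = (\<integral>\<omega>. real (dim_row X) * loss X \<mu> (obs \<mu> e \<omega>) \<alpha> \<partial>M)"

text \<open>Here \<open>rss\<close> values may vanish and \<open>ln 0 = 0\<close>; in the theorem they are all positive with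
  probability tending to 1, so this convention is immaterial.\<close>
definition Gamma_crit ::
  "real mat \<Rightarrow> nat \<Rightarrow> nat \<Rightarrow> (nat \<Rightarrow> nat set) \<Rightarrow> real vec \<Rightarrow> nat set \<Rightarrow> real" where
  "Gamma_crit X k r T y \<alpha> =
     (let n = dim_row X in
        ln (rss (submatrix X UNIV \<alpha>) y)
        - real (n - k) / (real n * real r)
            * (\<Sum>i<r. ln (rss (submatrix X (T i) \<alpha>) (subvec y (T i))))
        + 1 / (real n * real r)
            * (\<Sum>i<r. ln (det (gram (submatrix X UNIV \<alpha>)) / det (gram (submatrix X (T i) \<alpha>)))))"

definition a_coef :: "real mat \<Rightarrow> nat \<Rightarrow> (nat \<Rightarrow> nat set) \<Rightarrow> nat \<Rightarrow> nat set \<Rightarrow> real" where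
  "a_coef X k T i \<alpha> =
     (let n = dim_row X in
        ln (real (n - k) ^ card \<alpha> * det (gram (submatrix X UNIV \<alpha>))
            / (real n ^ card \<alpha> * det (gram (submatrix X (T i) \<alpha>)))))"

definition tendsto_in_prob ::
  "(nat \<Rightarrow> 'a measure) \<Rightarrow> (nat \<Rightarrow> 'a \<Rightarrow> real) \<Rightarrow> real \<Rightarrow> bool" where
  "tendsto_in_prob M Z c \<longleftrightarrow>
     (\<forall>\<epsilon>>0. (\<lambda>n. measure (M n) {\<omega> \<in> space (M n). \<epsilon> < \<bar>Z n \<omega> - c\<bar>}) \<longlonglongrightarrow> 0)"

end

theory Submission
  imports Defs
begin

text \<open>
  Since \<open>\<lambda>\<^sub>n \<rightarrow> \<infinity>\<close>, condition (iii) forces \<open>p\<^sub>n / n \<rightarrow> 0\<close>. The projections of all models are dominated by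
  the projection \<open>P\<close> of the full model, and \<open>E \<parallel>P e\<parallel>\<^sup>2 = \<sigma>\<^sup>2 p\<^sub>n\<close>; hence, uniformly over the models,
  \<open>L\<^sub>n(\<alpha>) = \<Delta>\<^sub>n(\<alpha>) + o(1)\<close> and \<open>S(\<alpha>) / n = \<Delta>\<^sub>n(\<alpha>) + W + o(1)\<close> in probability, where
  \<open>W = \<parallel>e\<parallel>\<^sup>2 / n\<close> does not depend on \<open>\<alpha>\<close> and is bounded in probability.
  The sums of \<open>log S\<^sub>i\<close> in the criterion lie between the positive value in (v) and \<open>r log \<parallel>y\<parallel>\<^sup>2\<close>, so after
  multiplication by \<open>(n - k) / (n r)\<close> they are negligible by (iii), and the determinant term is
  negligible by (iii) and (iv). Comparing the criterion at its minimizer with its value at the loss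
  minimizer, and using that \<open>W\<close> cancels up to a bounded factor, bounds the excess loss by \<open>o(1)\<close>,
  while (ii) keeps the minimal loss away from \<open>0\<close>.
\<close>

section \<open>Least-squares projections\<close>

lemma scalar_prod_lessThan: "dim_vec w = n \<Longrightarrow> scalar_prod v w = (\<Sum>i<n. v $ i * w $ i)"
  by (simp add: scalar_prod_def atLeast0LessThan)

lemma sqnorm_eq_sum: "sqnorm v = (\<Sum>i<dim_vec v. (v $ i)\<^sup>2)"
  by (simp add: sqnorm_def scalar_prod_lessThan power2_eq_square)

lemma sqnorm_nonneg: "0 \<le> sqnorm v"
  by (simp add: sqnorm_eq_sum sum_nonneg)

lemma sqnorm_minus:
  assumes "v \<in> carrier_vec n" "w \<in> carrier_vec n"
  shows "sqnorm (v - w) = sqnorm v - 2 * scalar_prod v w + sqnorm w"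
  using assms comm_scalar_prod[OF assms]
  by (simp add: sqnorm_def minus_scalar_prod_distrib[of _ n] scalar_prod_minus_distrib[of _ n])

lemma sqnorm_add:
  assumes "v \<in> carrier_vec n" "w \<in> carrier_vec n"
  shows "sqnorm (v + w) = sqnorm v + 2 * scalar_prod v w + sqnorm w"
  using assms comm_scalar_prod[OF assms]
  by (simp add: sqnorm_def add_scalar_prod_distrib[of _ n] scalar_prod_add_distrib[of _ n])

text \<open>By the parallelogram law the two sides differ by \<open>sqnorm (v - w)\<close>.\<close>

lemma sqnorm_add_le:
  assumes "v \<in> carrier_vec n" "w \<in> carrier_vec n"
  shows "sqnorm (v + w) \<le> 2 * (sqnorm v + sqnorm w)"
  using sqnorm_add[OF assms] sqnorm_minus[OF assms] sqnorm_nonneg[of "v - w"] by simp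

lemma scalar_prod_Cauchy_Schwarz:
  fixes v w :: "real vec"
  assumes "v \<in> carrier_vec n" "w \<in> carrier_vec n"
  shows "(scalar_prod v w)\<^sup>2 \<le> sqnorm v * sqnorm w"
  using Cauchy_Schwarz_ineq_sum[of "\<lambda>i. v $ i" "\<lambda>i. w $ i" "{..<n}"] assms
  by (simp add: sqnorm_eq_sum scalar_prod_lessThan)

section \<open>Nonsingular Gram matrices\<close>

lemma det_nonzero_if_invertible_mat:
  fixes A :: "'a :: field mat"
  assumes A: "A \<in> carrier_mat n n" and inv: "invertible_mat A"
  shows "det A \<noteq> 0"
proof -
  obtain B where B: "A * B = 1\<^sub>m n" "B * A = 1\<^sub>m (dim_row B)"
    using inv A by (auto simp: invertible_mat_def inverts_mat_def)
  \<comment> \<open>\<open>invertible_mat\<close> says nothing about the shape of the inverse; its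
    dimensions are read off the two product equations.\<close>
  have "dim_col B = n" using arg_cong[OF B(1), of dim_col] by simp
  moreover have "dim_row B = n" using arg_cong[OF B(2), of dim_col] A by simp
  ultimately have "B \<in> carrier_mat n n" by auto
  then have "det A * det B = 1" using det_mult[OF A] B(1) by (metis det_one)
  then show ?thesis by auto
qed

lemma gram_carrier: "Z \<in> carrier_mat n q \<Longrightarrow> gram Z \<in> carrier_mat q q"
  by (simp add: gram_def)

lemma gram_inverse:
  assumes Z: "Z \<in> carrier_mat n q" and det: "det (gram Z) \<noteq> 0"
  obtains B where "mat_inverse (gram Z) = Some B" "gram Z * B = 1\<^sub>m q" "B * gram Z = 1\<^sub>m q"
    "B \<in> carrier_mat q q"
proof (cases "mat_inverse (gram Z)")
  case None
  then show ?thesis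
    using mat_inverse(1)[OF gram_carrier[OF Z], where b = "()"]
      det_non_zero_imp_unit[OF gram_carrier[OF Z] det, where b = "()"] by simp
next
  case (Some B)
  then show ?thesis using mat_inverse(2)[OF gram_carrier[OF Z] Some] that by blast
qed

text \<open>\<open>gram Z\<close> and \<open>Z\<close> have the same kernel, because v'Z'Zv =
  ||Zv||^2. This allows nonsingularity to be transferred between designs through their
  kernels.\<close>

lemma det_gram_nonzero_iff:
  assumes Z: "Z \<in> carrier_mat n q"
  shows "det (gram Z) \<noteq> 0 \<longleftrightarrow> (\<forall>v \<in> carrier_vec q. Z *\<^sub>v v = 0\<^sub>v n \<longrightarrow> v = 0\<^sub>v q)"
proof -
  have "gram Z *\<^sub>v v = 0\<^sub>v q \<longleftrightarrow> Z *\<^sub>v v = 0\<^sub>v n" if v: "v \<in> carrier_vec q" for v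
  proof
    assume "gram Z *\<^sub>v v = 0\<^sub>v q"
    then have "transpose_mat Z *\<^sub>v (Z *\<^sub>v v) = 0\<^sub>v q"
      using Z v by (simp add: gram_def)
    then have "sqnorm (Z *\<^sub>v v) = 0"
      using transpose_vec_mult_scalar[OF Z v, of "Z *\<^sub>v v"] Z v by (simp add: sqnorm_def)
    then have "\<forall>i<n. (Z *\<^sub>v v) $ i = 0"
      using Z by (simp add: sqnorm_eq_sum sum_nonneg_eq_0_iff)
    then show "Z *\<^sub>v v = 0\<^sub>v n"
      using Z by (intro eq_vecI) auto
  next
    assume "Z *\<^sub>v v = 0\<^sub>v n"
    then show "gram Z *\<^sub>v v = 0\<^sub>v q"
      using Z v by (intro eq_vecI) (auto simp: gram_def scalar_prod_def)
  qed
  then show ?thesis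
    unfolding det_0_iff_vec_prod_zero[OF gram_carrier[OF Z]] by blast
qed

section \<open>Orthogonal projections as symmetric idempotent matrices\<close>

locale orth_proj =
  fixes P :: "real mat" and n :: nat
  assumes carrier: "P \<in> carrier_mat n n"
    and sym: "transpose_mat P = P"
    and idem: "P * P = P"
begin

lemma self_adjoint:
  "v \<in> carrier_vec n \<Longrightarrow> w \<in> carrier_vec n \<Longrightarrow>
    scalar_prod (P *\<^sub>v v) w = scalar_prod v (P *\<^sub>v w)"
  using transpose_vec_mult_scalar[OF carrier, of w v] by (simp add: sym)

lemma apply_carrier [simp]: "v \<in> carrier_vec n \<Longrightarrow> P *\<^sub>v v \<in> carrier_vec n"
  using carrier by simp

lemma apply_twice: "v \<in> carrier_vec n \<Longrightarrow> P *\<^sub>v (P *\<^sub>v v) = P *\<^sub>v v"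
  using assoc_mult_mat_vec[OF carrier carrier, of v] by (simp add: idem)

lemma sqnorm_apply: "v \<in> carrier_vec n \<Longrightarrow> sqnorm (P *\<^sub>v v) = scalar_prod v (P *\<^sub>v v)"
  by (simp add: sqnorm_def self_adjoint apply_twice)

lemma sqnorm_residual:
  "v \<in> carrier_vec n \<Longrightarrow> sqnorm (v - P *\<^sub>v v) = sqnorm v - scalar_prod v (P *\<^sub>v v)"
  by (simp add: sqnorm_minus[of _ n] sqnorm_apply)

lemma sqnorm_apply_le: "v \<in> carrier_vec n \<Longrightarrow> sqnorm (P *\<^sub>v v) \<le> sqnorm v"
  using sqnorm_residual[of v] sqnorm_nonneg[of "v - P *\<^sub>v v"] by (simp add: sqnorm_apply)

lemma quadratic_add:
  assumes v: "v \<in> carrier_vec n" and w: "w \<in> carrier_vec n"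
  shows "scalar_prod (v + w) (P *\<^sub>v (v + w)) =
    scalar_prod v (P *\<^sub>v v) + 2 * scalar_prod v (P *\<^sub>v w) + scalar_prod w (P *\<^sub>v w)"
proof -
  have "scalar_prod w (P *\<^sub>v v) = scalar_prod v (P *\<^sub>v w)"
    using self_adjoint[OF w v] comm_scalar_prod[of "P *\<^sub>v w" n v] v w by simp
  then show ?thesis
    using v w carrier
    by (simp add: mult_add_distrib_mat_vec[OF carrier] add_scalar_prod_distrib[OF v w]
        scalar_prod_add_distrib[of _ n])
qed

text \<open>The residual v - Pv is orthogonal to Pw, so the cross term vanishes. With v = \<mu> and
  w = e this splits the loss into its bias and its error part.\<close>

lemma sqnorm_minus_apply_add:
  assumes v: "v \<in> carrier_vec n" and w: "w \<in> carrier_vec n"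
  shows "sqnorm (v - P *\<^sub>v (v + w)) = sqnorm v - scalar_prod v (P *\<^sub>v v) + scalar_prod w (P *\<^sub>v w)"
proof -
  have vw: "v + w \<in> carrier_vec n" using v w by simp
  have "scalar_prod v (P *\<^sub>v (v + w)) = scalar_prod v (P *\<^sub>v v) + scalar_prod v (P *\<^sub>v w)"
    using v w by (simp add: mult_add_distrib_mat_vec[OF carrier] scalar_prod_add_distrib[of _ n])
  then show ?thesis
    using sqnorm_minus[OF v apply_carrier[OF vw]] sqnorm_apply[OF vw] quadratic_add[OF v w]
    by linarith
qed

text \<open>Here QP = P expresses that the range of P lies in that of Q. Transposing gives PQ = P,
  so Pv = P(Qv), and P does not increase norms.\<close>

lemma quadratic_mono:
  assumes Q: "orth_proj Q n" and QP: "Q * P = P" and v: "v \<in> carrier_vec n"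
  shows "scalar_prod v (P *\<^sub>v v) \<le> scalar_prod v (Q *\<^sub>v v)"
proof -
  interpret Q: orth_proj Q n by fact
  have "P * Q = P"
    using transpose_mult[OF Q.carrier carrier] by (simp add: QP sym Q.sym)
  then have "P *\<^sub>v v = P *\<^sub>v (Q *\<^sub>v v)"
    using assoc_mult_mat_vec[OF carrier Q.carrier v] by simp
  then have "sqnorm (P *\<^sub>v v) \<le> sqnorm (Q *\<^sub>v v)"
    using sqnorm_apply_le[of "Q *\<^sub>v v"] v by simp
  then show ?thesis using v by (simp add: sqnorm_apply Q.sqnorm_apply)
qed

end

section \<open>The projection onto the column space of a design matrix\<close>

lemma orth_proj_proj:
  assumes Z: "Z \<in> carrier_mat n q" and det: "det (gram Z) \<noteq> 0"
  shows "orth_proj (proj Z) n" and "proj Z * Z = Z"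
proof -
  obtain B where B: "mat_inverse (gram Z) = Some B" "gram Z * B = 1\<^sub>m q" "B * gram Z = 1\<^sub>m q"
    "B \<in> carrier_mat q q"
    using gram_inverse[OF Z det] .
  have P: "proj Z = Z * B * transpose_mat Z" by (simp add: proj_def B)
  have Zt: "transpose_mat Z \<in> carrier_mat q n" using Z by simp
  note G = gram_carrier[OF Z]
  have ZB: "Z * B \<in> carrier_mat n q" using Z B(4) by simp
  \<comment> \<open>Symmetry of the inverse: the transpose of B is again a left inverse of the
    symmetric matrix \<open>gram Z\<close>, hence equals B.\<close>
  have "transpose_mat (gram Z) = gram Z"
    using transpose_mult[OF Zt Z] by (simp add: gram_def)
  then have "transpose_mat B * gram Z = 1\<^sub>m q"
    using transpose_mult[OF G B(4)] B(2) by simp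
  then have Bt: "transpose_mat B = B"
    using assoc_mult_mat[of "transpose_mat B" q q "gram Z" q B q] B G by simp
  have "Z * B * transpose_mat Z * Z = Z * (B * gram Z)"
    using assoc_mult_mat[OF ZB Zt Z] assoc_mult_mat[OF Z B(4) G] by (simp add: gram_def)
  then show PZ: "proj Z * Z = Z"
    using Z by (simp add: P B)
  show "orth_proj (proj Z) n"
  proof
    show carrier: "proj Z \<in> carrier_mat n n" using Z B by (simp add: P)
    show "transpose_mat (proj Z) = proj Z"
      using transpose_mult[OF ZB Zt] transpose_mult[OF Z B(4)] assoc_mult_mat[OF Z B(4) Zt]
      by (simp only: P Bt transpose_transpose)
    have "proj Z * proj Z = proj Z * Z * B * transpose_mat Z"
      using assoc_mult_mat[OF carrier ZB Zt] assoc_mult_mat[OF carrier Z B(4)]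
      by (simp only: P)
    then show "proj Z * proj Z = proj Z" by (simp add: PZ) (simp add: P)
  qed
qed

lemma trace_mult_comm:
  fixes A :: "'a :: comm_semiring_0 mat"
  assumes "A \<in> carrier_mat n q" "B \<in> carrier_mat q n"
  shows "(\<Sum>i<n. (A * B) $$ (i, i)) = (\<Sum>a<q. (B * A) $$ (a, a))"
proof -
  have "(\<Sum>i<n. (A * B) $$ (i, i)) = (\<Sum>i<n. \<Sum>a<q. A $$ (i, a) * B $$ (a, i))"
    using assms by (intro sum.cong) (auto simp: scalar_prod_def atLeast0LessThan intro!: sum.cong)
  also have "\<dots> = (\<Sum>a<q. \<Sum>i<n. A $$ (i, a) * B $$ (a, i))" by (rule sum.swap)
  also have "\<dots> = (\<Sum>a<q. (B * A) $$ (a, a))"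
    using assms by (intro sum.cong)
      (auto simp: scalar_prod_def atLeast0LessThan mult.commute intro!: sum.cong)
  finally show ?thesis .
qed

text \<open>Cyclicity turns the trace of Z B Z' into that of B Z'Z, an identity matrix of size q. It
  makes the expected squared norm of a projected error vector proportional to the number of
  columns.\<close>

lemma trace_proj:
  assumes Z: "Z \<in> carrier_mat n q" and det: "det (gram Z) \<noteq> 0"
  shows "(\<Sum>i<n. proj Z $$ (i, i)) = real q"
proof -
  obtain B where B: "mat_inverse (gram Z) = Some B" "gram Z * B = 1\<^sub>m q" "B * gram Z = 1\<^sub>m q"
    "B \<in> carrier_mat q q"
    using gram_inverse[OF Z det] .
  have Zt: "transpose_mat Z \<in> carrier_mat q n" using Z by simp
  have "proj Z = Z * (B * transpose_mat Z)" using Z B(4) by (simp add: proj_def B(1))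
  moreover have "B * transpose_mat Z * Z = B * gram Z"
    using Z Zt B(4) by (simp add: gram_def)
  ultimately show ?thesis
    using trace_mult_comm[of Z n q "B * transpose_mat Z"] Z B by simp
qed

lemma rss_eq:
  assumes Z: "Z \<in> carrier_mat n q" and det: "det (gram Z) \<noteq> 0" and v: "v \<in> carrier_vec n"
  shows "rss Z v = sqnorm v - scalar_prod v (proj Z *\<^sub>v v)"
proof -
  interpret orth_proj "proj Z" n using orth_proj_proj[OF Z det] by simp
  obtain B where B: "mat_inverse (gram Z) = Some B" "B \<in> carrier_mat q q"
    using gram_inverse[OF Z det] .
  have Zt: "transpose_mat Z \<in> carrier_mat q n" using Z by simp
  have "Z *\<^sub>v beta_hat Z v = proj Z *\<^sub>v v"
    using assoc_mult_mat_vec[OF Z mult_carrier_mat[OF B(2) Zt] v] assoc_mult_mat[OF Z B(2) Zt]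
    by (simp only: beta_hat_def proj_def B(1) option.sel)
  then show ?thesis using sqnorm_residual[OF v] by (simp add: rss_def)
qed

section \<open>Selecting rows and columns of the design\<close>

lemma submatrix_carrier:
  assumes "X \<in> carrier_mat n p" "T \<subseteq> {..<n}" "\<alpha> \<subseteq> {..<p}"
  shows "submatrix X UNIV \<alpha> \<in> carrier_mat n (card \<alpha>)"
    "submatrix X T \<alpha> \<in> carrier_mat (card T) (card \<alpha>)"
proof -
  have "{i. i < n \<and> i \<in> T} = T" "{j. j < p \<and> j \<in> \<alpha>} = \<alpha>" using assms by auto
  then have "card {i. i < dim_row X \<and> i \<in> T} = card T" 
     "card {j. j < dim_col X \<and> j \<in> \<alpha>} = card \<alpha>" "card {i. i < dim_row X \<and> i \<in> UNIV} = n"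
    using carrier_matD[OF assms(1)] by simp_all
  then show "submatrix X UNIV \<alpha> \<in> carrier_mat n (card \<alpha>)"
    "submatrix X T \<alpha> \<in> carrier_mat (card T) (card \<alpha>)"
    by (intro carrier_matI, simp_all only: dim_submatrix)+
qed

lemma submatrix_rows_mult_vec:
  assumes X: "X \<in> carrier_mat n p" and T: "T \<subseteq> {..<n}" and \<alpha>: "\<alpha> \<subseteq> {..<p}"
    and v: "v \<in> carrier_vec (card \<alpha>)" and i: "i < card T"
  shows "(submatrix X T \<alpha> *\<^sub>v v) $ i = (submatrix X UNIV \<alpha> *\<^sub>v v) $ pick T i"
proof -
  note car = submatrix_carrier[OF X T \<alpha>]
  have eq: "{i. i < n \<and> i \<in> T} = T" "{j. j < p \<and> j \<in> \<alpha>} = \<alpha>" using T \<alpha> by auto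
  have pi: "pick T i < n" using pick_in_set_le[OF i] T by auto
  have "submatrix X T \<alpha> $$ (i, j) = submatrix X UNIV \<alpha> $$ (pick T i, j)" if "j < card \<alpha>" for j
    using that i pi X by (simp add: submatrix_index eq pick_UNIV)
  then have "row (submatrix X T \<alpha>) i = row (submatrix X UNIV \<alpha>) (pick T i)"
    using carrier_matD[OF car(1)] carrier_matD[OF car(2)] i pi by (intro eq_vecI) simp_all
  then show ?thesis
    using carrier_matD[OF car(1)] carrier_matD[OF car(2)] i pi by simp
qed

text \<open>A vector annihilated by all rows is annihilated by the training rows. Nonsingularity,
  assumed for training designs, thus passes to the full sample.\<close>

lemma det_gram_submatrix_UNIV:
  assumes X: "X \<in> carrier_mat n p" and T: "T \<subseteq> {..<n}" and \<alpha>: "\<alpha> \<subseteq> {..<p}"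
    and det: "det (gram (submatrix X T \<alpha>)) \<noteq> 0"
  shows "det (gram (submatrix X UNIV \<alpha>)) \<noteq> 0"
proof -
  note car = submatrix_carrier[OF X T \<alpha>]
  have "v = 0\<^sub>v (card \<alpha>)"
    if v: "v \<in> carrier_vec (card \<alpha>)" and 0: "submatrix X UNIV \<alpha> *\<^sub>v v = 0\<^sub>v n" for v
  proof -
    have "submatrix X T \<alpha> *\<^sub>v v = 0\<^sub>v (card T)"
    proof
      fix i assume i: "i < dim_vec (0\<^sub>v (card T) :: real vec)"
      then have "pick T i < n" using pick_in_set_le[of i T] T by auto
      then show "(submatrix X T \<alpha> *\<^sub>v v) $ i = 0\<^sub>v (card T) $ i"
        using submatrix_rows_mult_vec[OF X T \<alpha> v] i 0 by simp
    qed (use car in simp)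
    then show ?thesis using det v unfolding det_gram_nonzero_iff[OF car(2)] by blast
  qed
  then show ?thesis unfolding det_gram_nonzero_iff[OF car(1)] by blast
qed

lemma pick_lessThan: "j < p \<Longrightarrow> pick {..<p} j = j"
  using pick_reduce_set[of j p UNIV] by (simp add: pick_UNIV lessThan_def)

text \<open>E is the 0/1 matrix that selects the columns in \<alpha>. It is chosen before
  \<open>T\<close>, so one matrix serves the full sample and all training samples.\<close>

lemma submatrix_cols_eq_mult:
  fixes X :: "'a :: semiring_1 mat"
  assumes X: "X \<in> carrier_mat n p" and \<alpha>: "\<alpha> \<subseteq> {..<p}"
  shows "\<exists>E \<in> carrier_mat p (card \<alpha>). \<forall>T. submatrix X T \<alpha> = submatrix X T {..<p} * E"
proof -
  define E :: "'a mat"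
    where "E = mat p (card \<alpha>) (\<lambda>(i, j). if i = pick \<alpha> j then 1 else 0)"
  have \<alpha>_eq: "{j. j < p \<and> j \<in> \<alpha>} = \<alpha>" using \<alpha> by auto
  have E: "E \<in> carrier_mat p (card \<alpha>)" by (simp add: E_def)
  have "submatrix X T \<alpha> = submatrix X T {..<p} * E" for T
  proof (rule eq_matI)
    fix i j
    assume "i < dim_row (submatrix X T {..<p} * E)" "j < dim_col (submatrix X T {..<p} * E)"
    then have i: "i < card {i. i < n \<and> i \<in> T}" and j: "j < card \<alpha>"
      using carrier_matD[OF X] carrier_matD[OF E] by (auto simp: dim_submatrix)
    have pj: "pick \<alpha> j < p" using pick_in_set_le[OF j] \<alpha> by auto
    have "(submatrix X T {..<p} * E) $$ (i, j)
        = (\<Sum>l<p. submatrix X T {..<p} $$ (i, l) * E $$ (l, j))"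
      using i j carrier_matD[OF X] carrier_matD[OF E]
      by (simp add: dim_submatrix scalar_prod_def atLeast0LessThan)
    also have "\<dots> = (\<Sum>l<p. if l = pick \<alpha> j then X $$ (pick T i, l) else 0)"
      using i j carrier_matD[OF X]
      by (intro sum.cong) (auto simp: submatrix_index E_def pick_lessThan)
    also have "\<dots> = X $$ (pick T i, pick \<alpha> j)" using pj by simp
    also have "\<dots> = submatrix X T \<alpha> $$ (i, j)"
      using i j carrier_matD[OF X] by (simp add: submatrix_index \<alpha>_eq)
    finally show "submatrix X T \<alpha> $$ (i, j) = (submatrix X T {..<p} * E) $$ (i, j)" ..
  qed (use carrier_matD[OF X] carrier_matD[OF E] \<alpha>_eq in \<open>simp_all add: dim_submatrix\<close>)
  then show ?thesis using E by blast
qed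

text \<open>The columns of F * E are combinations of those of F, so \<open>proj F\<close> fixes F *
  E and therefore \<open>proj (F * E)\<close>; \<open>quadratic_mono\<close> applies.\<close>

lemma quadratic_proj_mult_le:
  assumes F: "F \<in> carrier_mat n p" and E: "E \<in> carrier_mat p q"
    and detF: "det (gram F) \<noteq> 0" and detZ: "det (gram (F * E)) \<noteq> 0"
    and v: "v \<in> carrier_vec n"
  shows "scalar_prod v (proj (F * E) *\<^sub>v v) \<le> scalar_prod v (proj F *\<^sub>v v)"
proof -
  have Z: "F * E \<in> carrier_mat n q" using F E by simp
  note opF = orth_proj_proj[OF F detF] and opZ = orth_proj_proj[OF Z detZ]
  interpret F: orth_proj "proj F" n by (fact opF)
  interpret Z: orth_proj "proj (F * E)" n by (fact opZ)
  obtain B where B: "mat_inverse (gram (F * E)) = Some B" "B \<in> carrier_mat q q"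
    using gram_inverse[OF Z detZ] .
  have Zt: "transpose_mat (F * E) \<in> carrier_mat q n" using Z by simp
  have FZ: "proj F * (F * E) = F * E"
    using assoc_mult_mat[OF F.carrier F E] opF(2) by simp
  have PZ: "proj (F * E) = F * E * (B * transpose_mat (F * E))"
    using assoc_mult_mat[OF Z B(2) Zt] by (simp only: proj_def B(1) option.sel)
  have "B * transpose_mat (F * E) \<in> carrier_mat q n"
    using mult_carrier_mat[OF B(2) Zt] .
  then have "proj F * proj (F * E) = proj (F * E)"
    using assoc_mult_mat[OF F.carrier Z] FZ by (simp only: PZ)
  then show ?thesis using Z.quadratic_mono[OF opF(1) _ v] by simp
qed

lemma subvec_carrier: "v \<in> carrier_vec n \<Longrightarrow> T \<subseteq> {..<n} \<Longrightarrow> subvec v T \<in> carrier_vec (card T)"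
proof -
  assume "v \<in> carrier_vec n" "T \<subseteq> {..<n}"
  moreover from this have "{i. i < n \<and> i \<in> T} = T" by auto
  ultimately show ?thesis by (simp add: subvec_def)
qed

lemma sqnorm_subvec_le:
  assumes v: "v \<in> carrier_vec n" and T: "T \<subseteq> {..<n}"
  shows "sqnorm (subvec v T) \<le> sqnorm v"
proof -
  have eq: "{i. i < n \<and> i \<in> T} = T" using T by auto
  \<comment> \<open>\<open>pick T\<close> is strictly increasing below \<open>card T\<close>, so the
    subvector lists distinct coordinates of v.\<close>
  have inj: "inj_on (pick T) {..<card T}"
    by (rule linorder_inj_onI) (metis lessThan_iff less_irrefl pick_mono_le, rule linear)
  have "sqnorm (subvec v T) = (\<Sum>i<card T. (v $ pick T i)\<^sup>2)"
    using v by (simp add: sqnorm_eq_sum subvec_def eq)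
  also have "\<dots> = (\<Sum>j\<in>pick T ` {..<card T}. (v $ j)\<^sup>2)"
    using sum.reindex[OF inj, of "\<lambda>j. (v $ j)\<^sup>2"] by (simp add: comp_def)
  also have "\<dots> \<le> (\<Sum>j<n. (v $ j)\<^sup>2)"
  proof (rule sum_mono2)
    show "pick T ` {..<card T} \<subseteq> {..<n}"
      using T pick_in_set_le[of _ T] by blast
  qed simp_all
  finally show ?thesis using carrier_vecD[OF v] by (simp add: sqnorm_eq_sum)
qed

section \<open>Comparison of criterion and loss\<close>

lemma nonsingular_designD:
  assumes "X \<in> carrier_mat n p" "T \<subseteq> {..<n}" "\<gamma> \<subseteq> {..<p}"
    and "det (gram (submatrix X T \<gamma>)) \<noteq> 0"
  shows "submatrix X UNIV \<gamma> \<in> carrier_mat n (card \<gamma>)"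
    "submatrix X T \<gamma> \<in> carrier_mat (card T) (card \<gamma>)"
    "det (gram (submatrix X UNIV \<gamma>)) \<noteq> 0"
  using submatrix_carrier[OF assms(1-3)] det_gram_submatrix_UNIV[OF assms] by auto

lemma Delta_eq:
  assumes X: "X \<in> carrier_mat n p" and \<gamma>: "\<gamma> \<subseteq> {..<p}" and n: "n > 0"
    and det: "det (gram (submatrix X UNIV \<gamma>)) \<noteq> 0" and \<mu>: "\<mu> \<in> carrier_vec n"
  shows "real n * Delta X \<mu> \<gamma> = sqnorm \<mu> - scalar_prod \<mu> (proj (submatrix X UNIV \<gamma>) *\<^sub>v \<mu>)"
proof -
  interpret orth_proj "proj (submatrix X UNIV \<gamma>)" n
    using orth_proj_proj[OF submatrix_carrier(1)[OF X subset_refl \<gamma>] det] by simp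
  have "(1\<^sub>m n - proj (submatrix X UNIV \<gamma>)) *\<^sub>v \<mu> = \<mu> - proj (submatrix X UNIV \<gamma>) *\<^sub>v \<mu>"
    using minus_mult_distrib_mat_vec[OF one_carrier_mat carrier \<mu>] \<mu> by simp
  then show ?thesis
    using n carrier_matD[OF X] scalar_prod_minus_distrib[OF \<mu> \<mu> apply_carrier[OF \<mu>]]
    by (simp add: Delta_def sqnorm_def)
qed

lemma Delta_le:
  assumes X: "X \<in> carrier_mat n p" and \<gamma>: "\<gamma> \<subseteq> {..<p}" and n: "n > 0"
    and det: "det (gram (submatrix X UNIV \<gamma>)) \<noteq> 0" and \<mu>: "\<mu> \<in> carrier_vec n"
  shows "real n * Delta X \<mu> \<gamma> \<le> sqnorm \<mu>"
proof -
  interpret orth_proj "proj (submatrix X UNIV \<gamma>)" n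
    using orth_proj_proj[OF submatrix_carrier(1)[OF X subset_refl \<gamma>] det] by simp
  show ?thesis
    using Delta_eq[OF assms] sqnorm_apply[OF \<mu>] sqnorm_nonneg[of "proj (submatrix X UNIV \<gamma>) *\<^sub>v \<mu>"]
    by simp
qed

lemma loss_eq:
  assumes X: "X \<in> carrier_mat n p" and \<gamma>: "\<gamma> \<subseteq> {..<p}" and n: "n > 0"
    and det: "det (gram (submatrix X UNIV \<gamma>)) \<noteq> 0"
    and \<mu>: "\<mu> \<in> carrier_vec n" and e: "e \<in> carrier_vec n"
  shows "real n * loss X \<mu> (\<mu> + e) \<gamma>
    = real n * Delta X \<mu> \<gamma> + scalar_prod e (proj (submatrix X UNIV \<gamma>) *\<^sub>v e)"
proof -
  interpret orth_proj "proj (submatrix X UNIV \<gamma>)" n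
    using orth_proj_proj[OF submatrix_carrier(1)[OF X subset_refl \<gamma>] det] by simp
  show ?thesis
    using n carrier_matD[OF X] sqnorm_minus_apply_add[OF \<mu> e] Delta_eq[OF X \<gamma> n det \<mu>]
    by (simp add: loss_def)
qed

text \<open>The source of uniformity over the models: one bound on the form of the full model
  controls every candidate. The version for training rows serves to compare residual sums of
  squares.\<close>

lemma quadratic_submatrix_le_full:
  assumes X: "X \<in> carrier_mat n p" and T: "T \<subseteq> {..<n}" and \<gamma>: "\<gamma> \<subseteq> {..<p}"
    and det: "det (gram (submatrix X T \<gamma>)) \<noteq> 0"
    and detF: "det (gram (submatrix X T {..<p})) \<noteq> 0"
  shows "v \<in> carrier_vec n \<Longrightarrow> scalar_prod v (proj (submatrix X UNIV \<gamma>) *\<^sub>v v)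
      \<le> scalar_prod v (proj (submatrix X UNIV {..<p}) *\<^sub>v v)"
    and "w \<in> carrier_vec (card T) \<Longrightarrow> scalar_prod w (proj (submatrix X T \<gamma>) *\<^sub>v w)
      \<le> scalar_prod w (proj (submatrix X T {..<p}) *\<^sub>v w)"
proof -
  note D = nonsingular_designD[OF X T \<gamma> det] and F = nonsingular_designD[OF X T subset_refl detF]
  obtain E where E: "E \<in> carrier_mat p (card \<gamma>)"
    and eq: "\<And>T. submatrix X T \<gamma> = submatrix X T {..<p} * E"
    using submatrix_cols_eq_mult[OF X \<gamma>] by blast
  have card: "card {..<p} = p" by simp
  show "scalar_prod v (proj (submatrix X UNIV \<gamma>) *\<^sub>v v)
      \<le> scalar_prod v (proj (submatrix X UNIV {..<p}) *\<^sub>v v)" if "v \<in> carrier_vec n"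
    using quadratic_proj_mult_le[OF F(1)[unfolded card] E F(3), of v] that D(3)
    unfolding eq[symmetric] by blast
  show "scalar_prod w (proj (submatrix X T \<gamma>) *\<^sub>v w)
      \<le> scalar_prod w (proj (submatrix X T {..<p}) *\<^sub>v w)" if "w \<in> carrier_vec (card T)"
    using quadratic_proj_mult_le[OF F(2)[unfolded card] E detF, of w] that det
    unfolding eq[symmetric] by blast
qed

text \<open>Enlarging a model enlarges the projection and shrinks the residual. The lower bound
  links every candidate to the full model, the only one that condition (v) speaks about.\<close>

lemma rss_training_bounds:
  assumes X: "X \<in> carrier_mat n p" and T: "T \<subseteq> {..<n}" and \<gamma>: "\<gamma> \<subseteq> {..<p}"
    and det: "det (gram (submatrix X T \<gamma>)) \<noteq> 0"
    and detF: "det (gram (submatrix X T {..<p})) \<noteq> 0" and y: "y \<in> carrier_vec n"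
  shows "rss (submatrix X T {..<p}) (subvec y T) \<le> rss (submatrix X T \<gamma>) (subvec y T)"
    and "rss (submatrix X T \<gamma>) (subvec y T) \<le> sqnorm y"
proof -
  note D = nonsingular_designD[OF X T \<gamma> det] and F = nonsingular_designD[OF X T subset_refl detF]
  note w = subvec_carrier[OF y T]
  interpret orth_proj "proj (submatrix X T \<gamma>)" "card T"
    using orth_proj_proj[OF D(2) det] by simp
  show "rss (submatrix X T {..<p}) (subvec y T) \<le> rss (submatrix X T \<gamma>) (subvec y T)"
    using rss_eq[OF D(2) det w] rss_eq[OF F(2) detF w]
      quadratic_submatrix_le_full(2)[OF X T \<gamma> det detF w] by simp
  show "rss (submatrix X T \<gamma>) (subvec y T) \<le> sqnorm y"
    using rss_eq[OF D(2) det w] sqnorm_apply[OF w] sqnorm_subvec_le[OF y T]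
      sqnorm_nonneg[of "proj (submatrix X T \<gamma>) *\<^sub>v subvec y T"] by simp
qed

text \<open>The remainder is 2\<mu>'e - 2\<mu>'Pe - e'Pe. The outer terms account for
  \<open>3 * \<eta>\<close>; Cauchy-Schwarz with ||\<mu>||^2 \<le> Cn and ||Pe||^2 \<le> \<eta>n
  gives the square root.\<close>

lemma rss_approx:
  assumes X: "X \<in> carrier_mat n p" and \<gamma>: "\<gamma> \<subseteq> {..<p}" and n: "n > 0"
    and det: "det (gram (submatrix X UNIV \<gamma>)) \<noteq> 0"
    and \<mu>: "\<mu> \<in> carrier_vec n" and e: "e \<in> carrier_vec n"
    and quad: "scalar_prod e (proj (submatrix X UNIV \<gamma>) *\<^sub>v e) \<le> \<eta> * real n"
    and lin: "\<bar>scalar_prod \<mu> e\<bar> \<le> \<eta> * real n"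
    and C: "sqnorm \<mu> \<le> C * real n"
  shows "\<bar>rss (submatrix X UNIV \<gamma>) (\<mu> + e) - real n * Delta X \<mu> \<gamma> - sqnorm e\<bar>
    \<le> (3 * \<eta> + 2 * sqrt (\<eta> * C)) * real n"
proof -
  let ?Z = "submatrix X UNIV \<gamma>"
  note Z = submatrix_carrier(1)[OF X subset_refl \<gamma>]
  interpret orth_proj "proj ?Z" n using orth_proj_proj[OF Z det] by simp
  have ye: "\<mu> + e \<in> carrier_vec n" using \<mu> e by simp
  have q0: "0 \<le> scalar_prod e (proj ?Z *\<^sub>v e)"
    using sqnorm_apply[OF e] sqnorm_nonneg[of "proj ?Z *\<^sub>v e"] by simp
  have "(scalar_prod \<mu> (proj ?Z *\<^sub>v e))\<^sup>2 \<le> sqnorm \<mu> * scalar_prod e (proj ?Z *\<^sub>v e)"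
    using scalar_prod_Cauchy_Schwarz[OF \<mu> apply_carrier[OF e]] sqnorm_apply[OF e] by simp
  also have "\<dots> \<le> (C * real n) * (\<eta> * real n)"
    using C quad q0 sqnorm_nonneg[of \<mu>] by (intro mult_mono) auto
  also have "\<dots> = \<eta> * C * (real n)\<^sup>2" by (simp add: power2_eq_square)
  finally have "\<bar>scalar_prod \<mu> (proj ?Z *\<^sub>v e)\<bar> \<le> sqrt (\<eta> * C) * real n"
    using real_sqrt_le_mono[of _ "\<eta> * C * (real n)\<^sup>2"] by (fastforce simp: real_sqrt_mult)
  moreover have "rss ?Z (\<mu> + e) - real n * Delta X \<mu> \<gamma> - sqnorm e = 2 * scalar_prod \<mu> e
      - 2 * scalar_prod \<mu> (proj ?Z *\<^sub>v e) - scalar_prod e (proj ?Z *\<^sub>v e)"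
    using rss_eq[OF Z det ye] quadratic_add[OF \<mu> e] sqnorm_add[OF \<mu> e]
      Delta_eq[OF X \<gamma> n det \<mu>] by simp
  ultimately show ?thesis using q0 quad lin by (simp add: distrib_right abs_le_iff)
qed

text \<open>\<open>a_coef\<close> differs from the logarithm of the determinant ratio by the power
  of (n - k) / n, which contributes the same multiple of \<lambda> for each training sample.\<close>

lemma average_ln_det_ratio_eq:
  assumes X: "X \<in> carrier_mat n p" and k: "k < n" and r: "1 \<le> r"
    and detU: "det (gram (submatrix X UNIV \<gamma>)) \<noteq> 0"
    and det: "\<And>i. i < r \<Longrightarrow> det (gram (submatrix X (T i) \<gamma>)) \<noteq> 0"
  shows "1 / (real n * real r)
      * (\<Sum>i<r. ln (det (gram (submatrix X UNIV \<gamma>)) / det (gram (submatrix X (T i) \<gamma>))))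
    = 1 / (real n * real r) * (\<Sum>i<r. a_coef X k T i \<gamma>)
      + real (card \<gamma>) * ln (real n / real (n - k)) / real n"
proof -
  let ?d = "\<lambda>i. det (gram (submatrix X UNIV \<gamma>)) / det (gram (submatrix X (T i) \<gamma>))"
  have nk: "real n \<noteq> 0" "real (n - k) \<noteq> 0" "real r \<noteq> 0" using k r by auto
  have "ln (?d i) = a_coef X k T i \<gamma> + real (card \<gamma>) * ln (real n / real (n - k))"
    if "i < r" for i
  proof -
    have "real (n - k) ^ card \<gamma> * det (gram (submatrix X UNIV \<gamma>))
        / (real n ^ card \<gamma> * det (gram (submatrix X (T i) \<gamma>)))
      = (real (n - k) / real n) ^ card \<gamma> * ?d i"
      by (simp add: power_divide)
    moreover have "ln \<dots> = real (card \<gamma>) * ln (real (n - k) / real n) + ln (?d i)"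
    proof -
      \<comment> \<open>The logarithm of the product splits once both factors are nonzero; the signs
        of the determinants are not determined.\<close>
      have "(real (n - k) / real n) ^ card \<gamma> \<noteq> 0" "?d i \<noteq> 0" using det[OF that] detU nk by simp_all
      then show ?thesis by (simp only: ln_mult ln_realpow simp_thms if_True)
    qed
    ultimately have "a_coef X k T i \<gamma> = real (card \<gamma>) * ln (real (n - k) / real n) + ln (?d i)"
      using carrier_matD[OF X] by (simp add: a_coef_def)
    moreover have "ln (real n / real (n - k)) = - ln (real (n - k) / real n)"
      using nk by (simp add: ln_div)
    ultimately show ?thesis by simp
  qed
  then have "(\<Sum>i<r. ln (?d i))
      = (\<Sum>i<r. a_coef X k T i \<gamma>) + real r * (real (card \<gamma>) * ln (real n / real (n - k)))"
    by (simp add: sum.distrib)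
  then show ?thesis using nk by (simp add: field_simps)
qed

text \<open>The deterministic core. \<open>\<eta>\<close> bounds the projected error and |\<mu>'e|
  per observation, \<open>K\<close> bounds ||e||^2 / n, \<open>\<tau>\<close> is the error of
  \<open>rss_approx\<close>, and \<open>\<rho>\<close> collects the training and determinant terms.
  The comparison of criteria becomes S(a) \<le> exp \<rho> S(b); subtracting S(b) cancels ||e||^2
  and leaves a comparison of \<open>Delta\<close>, hence of losses.\<close>

lemma loss_le_of_Gamma_le:
  fixes a b :: "nat set"
  assumes X: "X \<in> carrier_mat n p" and \<mu>: "\<mu> \<in> carrier_vec n" and e: "e \<in> carrier_vec n"
    and k: "k < n" and r: "1 \<le> r" and T: "\<And>i. i < r \<Longrightarrow> T i \<subseteq> {..<n}"
    and ab: "a \<subseteq> {..<p}" "b \<subseteq> {..<p}"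
    and det: "\<And>i \<gamma>. i < r \<Longrightarrow> \<gamma> \<in> {{..<p}, a, b} \<Longrightarrow> det (gram (submatrix X (T i) \<gamma>)) \<noteq> 0"
    and quad: "scalar_prod e (proj (submatrix X UNIV {..<p}) *\<^sub>v e) \<le> \<eta> * real n"
    and lin: "\<bar>scalar_prod \<mu> e\<bar> \<le> \<eta> * real n"
    and K: "sqnorm e \<le> K * real n" "1 \<le> K"
    and C: "sqnorm \<mu> \<le> C * real n" "0 \<le> C"
    and pos: "\<And>i. i < r \<Longrightarrow> 0 < rss (submatrix X (T i) {..<p}) (subvec (\<mu> + e) (T i))"
    and pos_sum: "0 \<le> (\<Sum>i<r. ln (rss (submatrix X (T i) {..<p}) (subvec (\<mu> + e) (T i))))"
    and \<delta>: "\<delta> \<le> Delta X \<mu> a" "\<delta> \<le> Delta X \<mu> b"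
    and \<tau>: "\<tau> = 3 * \<eta> + 2 * sqrt (\<eta> * C)" "\<tau> < \<delta>"
    and t: "\<And>\<gamma>. \<gamma> \<in> {a, b} \<Longrightarrow> \<bar>1 / (real n * real r) * (\<Sum>i<r. a_coef X k T i \<gamma>)\<bar> \<le> t"
    and \<rho>: "real (n - k) / real n * ln (2 * (C + K) * real n)
        + 2 * (t + real p * ln (real n / real (n - k)) / real n) \<le> \<rho>"
    and Gamma: "Gamma_crit X k r T (\<mu> + e) a \<le> Gamma_crit X k r T (\<mu> + e) b"
  shows "loss X \<mu> (\<mu> + e) a \<le> loss X \<mu> (\<mu> + e) b + ((exp \<rho> - 1) * (C + K + \<tau>) + 2 * \<tau> + \<eta>)"
    and "\<delta> \<le> loss X \<mu> (\<mu> + e) b"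
proof -
  have n: "0 < n" using k by simp
  have r0: "0 < r" using r by simp
  have \<eta>: "0 \<le> \<eta>" using lin n by (meson abs_ge_zero of_nat_0_less_iff order_trans zero_le_mult_iff not_less)
  have \<tau>0: "0 \<le> \<tau>" using \<eta> C(2) by (simp add: \<tau>)
  let ?y = "\<mu> + e" and ?lam = "ln (real n / real (n - k))"
  have y: "?y \<in> carrier_vec n" using \<mu> e by simp
  have lam0: "0 \<le> ?lam" using k by simp
  \<comment> \<open>A common upper bound for ||y||^2 and so for all training residual sums of
    squares; the factor 2 comes from \<open>sqnorm_add_le\<close>.\<close>
  define Y where "Y = 2 * (C + K) * real n"
  have "sqnorm ?y \<le> Y" using sqnorm_add_le[OF \<mu> e] K C by (simp add: Y_def algebra_simps)
  have sub: "\<gamma> \<subseteq> {..<p}" if "\<gamma> \<in> {a, b}" for \<gamma> using that ab by auto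
  have detU: "det (gram (submatrix X UNIV \<gamma>)) \<noteq> 0" if "\<gamma> \<in> {a, b}" for \<gamma>
    using det_gram_submatrix_UNIV[OF X T[OF r0] sub[OF that] det[OF r0]] that by blast
  have quad': "scalar_prod e (proj (submatrix X UNIV \<gamma>) *\<^sub>v e) \<le> \<eta> * real n"
    if "\<gamma> \<in> {a, b}" for \<gamma>
    using quadratic_submatrix_le_full(1)[OF X T[OF r0] sub[OF that] det[OF r0] det[OF r0] e]
      quad that by fastforce
  define S where "S \<gamma> = rss (submatrix X UNIV \<gamma>) ?y" for \<gamma>
  define s where "s i \<gamma> = rss (submatrix X (T i) \<gamma>) (subvec ?y (T i))" for i \<gamma>
  define u where "u \<gamma> = real (n - k) / (real n * real r) * (\<Sum>i<r. ln (s i \<gamma>))" for \<gamma>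
  define w where "w \<gamma> = 1 / (real n * real r)
    * (\<Sum>i<r. ln (det (gram (submatrix X UNIV \<gamma>)) / det (gram (submatrix X (T i) \<gamma>))))" for \<gamma>
  have Gamma_eq: "Gamma_crit X k r T ?y \<gamma> = ln (S \<gamma>) - u \<gamma> + w \<gamma>" for \<gamma>
    using carrier_matD[OF X] by (simp add: Gamma_crit_def S_def s_def u_def w_def Let_def)
  have s_lower: "s i {..<p} \<le> s i \<gamma>" and s_upper: "s i \<gamma> \<le> Y" and s_pos: "0 < s i {..<p}"
    if "i < r" "\<gamma> \<in> {a, b}" for i \<gamma>
    using rss_training_bounds[OF X T[OF that(1)] sub[OF that(2)] det[OF that(1)] det[OF that(1)] y]
      that pos[OF that(1)] \<open>sqnorm ?y \<le> Y\<close> by (fastforce simp: s_def)+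
  have u_upper: "u \<gamma> \<le> real (n - k) / real n * ln Y" if "\<gamma> \<in> {a, b}" for \<gamma>
  proof -
    have "(\<Sum>i<r. ln (s i \<gamma>)) \<le> real (card {..<r}) * ln Y"
      using s_upper less_le_trans[OF s_pos s_lower] that
      by (intro sum_bounded_above ln_mono) auto
    then have "u \<gamma> \<le> real (n - k) / (real n * real r) * (real r * ln Y)"
      unfolding u_def by (intro mult_left_mono) auto
    then show ?thesis using r0 by simp
  qed
  \<comment> \<open>\<open>pos_sum\<close> concerns the full model, whose residual sums of squares
    are positive and lie below those of \<gamma>, so monotonicity of \<open>ln\<close> carries the
    sign over.\<close>
  have u_lower: "0 \<le> u \<gamma>" if "\<gamma> \<in> {a, b}" for \<gamma>
  proof -
    have "(\<Sum>i<r. ln (s i {..<p})) \<le> (\<Sum>i<r. ln (s i \<gamma>))"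
      using s_lower s_pos that by (intro sum_mono ln_mono) auto
    then have "0 \<le> (\<Sum>i<r. ln (s i \<gamma>))" using pos_sum by (simp add: s_def)
    then show ?thesis by (simp add: u_def)
  qed
  have w_bound: "\<bar>w \<gamma>\<bar> \<le> t + real p * ?lam / real n" if "\<gamma> \<in> {a, b}" for \<gamma>
  proof -
    have "card \<gamma> \<le> p" using card_mono[OF _ sub[OF that]] by simp
    then have "real (card \<gamma>) * ?lam / real n \<le> real p * ?lam / real n"
      using lam0 by (intro divide_right_mono mult_right_mono) auto
    moreover have "0 \<le> real (card \<gamma>) * ?lam / real n" using lam0 by simp
    ultimately have "\<bar>x + real (card \<gamma>) * ?lam / real n\<bar> \<le> t + real p * ?lam / real n"
      if "\<bar>x\<bar> \<le> t" for x using that by linarith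
    moreover have "w \<gamma> = 1 / (real n * real r) * (\<Sum>i<r. a_coef X k T i \<gamma>)
        + real (card \<gamma>) * ?lam / real n"
      unfolding w_def using that det by (intro average_ln_det_ratio_eq[OF X k r detU]) auto
    ultimately show ?thesis using t[OF that] by (simp only:)
  qed
  have S_bound: "\<bar>S \<gamma> - real n * Delta X \<mu> \<gamma> - sqnorm e\<bar> \<le> \<tau> * real n" if "\<gamma> \<in> {a, b}" for \<gamma>
    using rss_approx[OF X sub[OF that] n detU[OF that] \<mu> e quad'[OF that] lin C(1)]
    by (simp add: S_def \<tau>)
  \<comment> \<open>The margin \<tau> < \<delta> keeps S positive, so that \<open>exp\<close> undoes
    \<open>ln\<close> below.\<close>
  have S_pos: "0 < S \<gamma>" if "\<gamma> \<in> {a, b}" for \<gamma>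
  proof -
    have "\<tau> * real n < real n * Delta X \<mu> \<gamma>" using that \<delta> \<tau>(2) n by auto
    then show ?thesis using S_bound[OF that] sqnorm_nonneg[of e] by linarith
  qed
  have mem: "a \<in> {a, b}" "b \<in> {a, b}" by simp_all
  \<comment> \<open>Pure arithmetic over fresh reals: the training term of \<open>a\<close> costs at
    most Z, that of \<open>b\<close> is nonnegative and is dropped, and each of the two determinant
    terms costs y0.\<close>
  have "x \<le> x' + \<rho>"
    if "x - z + y \<le> x' - z' + y'" "z \<le> Z" "0 \<le> z'" "\<bar>y\<bar> \<le> y0" "\<bar>y'\<bar> \<le> y0" "Z + 2 * y0 \<le> \<rho>"
    for x x' y y' z z' Z y0 :: real using that by linarith
  from this[OF Gamma[unfolded Gamma_eq] u_upper[OF mem(1)] u_lower[OF mem(2)]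
      w_bound[OF mem(1)] w_bound[OF mem(2)] \<rho>[folded Y_def]]
  have "ln (S a) \<le> ln (S b) + \<rho>" .
  then have "exp (ln (S a)) \<le> exp (ln (S b) + \<rho>)" by simp
  then have S_le: "S a \<le> exp \<rho> * S b" using S_pos by (simp add: exp_add mult.commute)
  \<comment> \<open>The next facts lead to 0 \<le> \<rho>, which makes exp \<rho> - 1 a nonnegative
    factor by which the bound on S(b) may be multiplied.\<close>
  have t0: "0 \<le> t" using t[of a] abs_ge_zero order_trans by blast
  have "1 \<le> 2 * (C + K) * real n"
    using C(2) K(2) n mult_mono[of 1 "2 * (C + K)" 1 "real n"] by simp
  then have "0 \<le> real (n - k) / real n * ln (2 * (C + K) * real n)" by simp
  moreover have "0 \<le> 2 * (t + real p * ?lam / real n)" using lam0 t0 by simp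
  ultimately have \<rho>0: "0 \<le> \<rho>" using order_trans[OF add_nonneg_nonneg \<rho>] by blast
  have "S b \<le> (C + K + \<tau>) * real n"
    using S_bound[of b] Delta_le[OF X ab(2) n detU \<mu>] C(1) K(1) by (simp add: algebra_simps)
  then have "(exp \<rho> - 1) * S b \<le> (exp \<rho> - 1) * ((C + K + \<tau>) * real n)"
    using \<rho>0 by (intro mult_left_mono) auto
  then have "real n * Delta X \<mu> a \<le> real n * Delta X \<mu> b
      + (exp \<rho> - 1) * ((C + K + \<tau>) * real n) + 2 * \<tau> * real n"
    using S_le S_bound[of a] S_bound[of b] by (simp add: left_diff_distrib)
  moreover have loss: "real n * loss X \<mu> ?y \<gamma>
      = real n * Delta X \<mu> \<gamma> + scalar_prod e (proj (submatrix X UNIV \<gamma>) *\<^sub>v e)"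
    if "\<gamma> \<in> {a, b}" for \<gamma> using loss_eq[OF X sub[OF that] n detU[OF that] \<mu> e] .
  \<comment> \<open>The error part of the loss of \<open>b\<close> is dropped by its sign; that of
    \<open>a\<close> contributes the final summand \<open>\<eta>\<close>.\<close>
  moreover have q0: "0 \<le> scalar_prod e (proj (submatrix X UNIV b) *\<^sub>v e)"
  proof -
    interpret orth_proj "proj (submatrix X UNIV b)" n
      using orth_proj_proj[OF submatrix_carrier(1)[OF X subset_refl ab(2)] detU] by simp
    show ?thesis
      using sqnorm_apply[OF e] sqnorm_nonneg[of "proj (submatrix X UNIV b) *\<^sub>v e"] by simp
  qed
  ultimately have "real n * loss X \<mu> ?y a
      \<le> real n * (loss X \<mu> ?y b + ((exp \<rho> - 1) * (C + K + \<tau>) + 2 * \<tau> + \<eta>))"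
    using quad'[of a] loss[of a] loss[of b] by (simp add: algebra_simps)
  then show "loss X \<mu> ?y a \<le> loss X \<mu> ?y b + ((exp \<rho> - 1) * (C + K + \<tau>) + 2 * \<tau> + \<eta>)"
    using n by simp
  have "real n * \<delta> \<le> real n * Delta X \<mu> b" using \<delta>(2) by (intro mult_left_mono) auto
  then have "real n * \<delta> \<le> real n * loss X \<mu> ?y b" using loss[of b] q0 by simp
  then show "\<delta> \<le> loss X \<mu> ?y b" using n by simp
qed

section \<open>Moment bounds for the errors\<close>

context prob_space
begin

text \<open>Independence and centring remove the off-diagonal products, so only the trace of A
  survives.\<close>

lemma quadratic_form_errors:
  fixes \<epsilon> :: "nat \<Rightarrow> 'a \<Rightarrow> real" and A :: "nat \<Rightarrow> nat \<Rightarrow> real"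
  assumes indep: "indep_vars (\<lambda>_. borel) \<epsilon> {..<n}"
    and int1: "\<And>j. j < n \<Longrightarrow> integrable M (\<epsilon> j)"
    and mean: "\<And>j. j < n \<Longrightarrow> expectation (\<epsilon> j) = 0"
    and int2: "\<And>j. j < n \<Longrightarrow> integrable M (\<lambda>\<omega>. (\<epsilon> j \<omega>)\<^sup>2)"
    and var: "\<And>j. j < n \<Longrightarrow> variance (\<epsilon> j) = v"
  shows "integrable M (\<lambda>\<omega>. \<Sum>i<n. \<Sum>j<n. A i j * (\<epsilon> i \<omega> * \<epsilon> j \<omega>))"
    and "expectation (\<lambda>\<omega>. \<Sum>i<n. \<Sum>j<n. A i j * (\<epsilon> i \<omega> * \<epsilon> j \<omega>)) = v * (\<Sum>i<n. A i i)"
proof -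
  have cross: "integrable M (\<lambda>\<omega>. \<epsilon> i \<omega> * \<epsilon> j \<omega>)
      \<and> expectation (\<lambda>\<omega>. \<epsilon> i \<omega> * \<epsilon> j \<omega>) = (if i = j then v else 0)"
    if ij: "i < n" "j < n" for i j
  proof (cases "i = j")
    case True
    then show ?thesis
      using int2[OF ij(1)] var[OF ij(1)] mean[OF ij(1)] by (simp add: power2_eq_square)
  next
    case False
    have ind: "indep_vars (\<lambda>_. borel) \<epsilon> {i, j}"
      using indep_vars_subset[OF indep] ij by simp
    have int: "\<And>l. l \<in> {i, j} \<Longrightarrow> integrable M (\<epsilon> l)" using int1 ij by auto
    show ?thesis
      using indep_vars_integrable[OF _ ind int] indep_vars_lebesgue_integral[OF _ ind int]
        False mean ij by simp
  qed
  show "integrable M (\<lambda>\<omega>. \<Sum>i<n. \<Sum>j<n. A i j * (\<epsilon> i \<omega> * \<epsilon> j \<omega>))"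
    using cross by (intro Bochner_Integration.integrable_sum integrable_mult_right) auto
  have "expectation (\<lambda>\<omega>. \<Sum>i<n. \<Sum>j<n. A i j * (\<epsilon> i \<omega> * \<epsilon> j \<omega>))
      = (\<Sum>i<n. expectation (\<lambda>\<omega>. \<Sum>j<n. A i j * (\<epsilon> i \<omega> * \<epsilon> j \<omega>)))"
    using cross
    by (intro Bochner_Integration.integral_sum Bochner_Integration.integrable_sum
        integrable_mult_right) auto
  also have "\<dots> = (\<Sum>i<n. \<Sum>j<n. expectation (\<lambda>\<omega>. A i j * (\<epsilon> i \<omega> * \<epsilon> j \<omega>)))"
    using cross by (intro sum.cong refl Bochner_Integration.integral_sum integrable_mult_right) auto
  also have "\<dots> = (\<Sum>i<n. \<Sum>j<n. A i j * (if i = j then v else 0))"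
    using cross by (intro sum.cong refl) simp
  finally show "expectation (\<lambda>\<omega>. \<Sum>i<n. \<Sum>j<n. A i j * (\<epsilon> i \<omega> * \<epsilon> j \<omega>)) = v * (\<Sum>i<n. A i i)"
    by (simp add: if_distrib sum_distrib_left mult.commute cong: if_cong)
qed

text \<open>One tail bound for three uses: A will be a projection matrix, \<mu>\<mu>' and the
  identity. Measurability is recorded for the later union bound.\<close>

lemma quadratic_form_Markov:
  fixes \<epsilon> :: "nat \<Rightarrow> 'a \<Rightarrow> real" and A :: "nat \<Rightarrow> nat \<Rightarrow> real" and n :: nat
  assumes err: "indep_vars (\<lambda>_. borel) \<epsilon> {..<n}"
      "\<And>j. j < n \<Longrightarrow> integrable M (\<epsilon> j)"
      "\<And>j. j < n \<Longrightarrow> expectation (\<epsilon> j) = 0"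
      "\<And>j. j < n \<Longrightarrow> integrable M (\<lambda>\<omega>. (\<epsilon> j \<omega>)\<^sup>2)"
      "\<And>j. j < n \<Longrightarrow> variance (\<epsilon> j) = v"
    and Q: "\<And>\<omega>. Q \<omega> = (\<Sum>i<n. \<Sum>j<n. A i j * (\<epsilon> i \<omega> * \<epsilon> j \<omega>))"
    and nonneg: "\<And>\<omega>. 0 \<le> Q \<omega>" and c: "0 < c"
  shows "{\<omega> \<in> space M. c \<le> Q \<omega>} \<in> events"
    and "prob {\<omega> \<in> space M. c \<le> Q \<omega>} \<le> v * (\<Sum>i<n. A i i) / c"
proof -
  note moments = quadratic_form_errors[of \<epsilon> n v A, OF err]
  have int: "integrable M Q"
    using moments(1) by (simp add: Q[abs_def])
  then show "{\<omega> \<in> space M. c \<le> Q \<omega>} \<in> events" by measurable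
  show "prob {\<omega> \<in> space M. c \<le> Q \<omega>} \<le> v * (\<Sum>i<n. A i i) / c"
    using integral_Markov_inequality_measure[OF int sets.top _ c] nonneg moments(2)
    by (simp add: Q[abs_def])
qed

text \<open>The three bounds are Markov's inequality with traces p, ||\<mu>||^2 and n. The second is
  in effect Chebyshev's inequality, through the square of \<mu>'e.\<close>

lemma error_events:
  fixes \<epsilon> :: "nat \<Rightarrow> 'a \<Rightarrow> real" and F :: "real mat" and n :: nat
  defines "E \<equiv> \<lambda>\<omega>. Matrix.vec n (\<lambda>j. \<epsilon> j \<omega>)"
  assumes err: "indep_vars (\<lambda>_. borel) \<epsilon> {..<n}"
      "\<And>j. j < n \<Longrightarrow> integrable M (\<epsilon> j)"
      "\<And>j. j < n \<Longrightarrow> expectation (\<epsilon> j) = 0"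
      "\<And>j. j < n \<Longrightarrow> integrable M (\<lambda>\<omega>. (\<epsilon> j \<omega>)\<^sup>2)"
      "\<And>j. j < n \<Longrightarrow> variance (\<epsilon> j) = v"
    and F: "F \<in> carrier_mat n p" "det (gram F) \<noteq> 0" and \<mu>: "\<mu> \<in> carrier_vec n"
    and c: "0 < c"
  shows "{\<omega> \<in> space M. c \<le> scalar_prod (E \<omega>) (proj F *\<^sub>v E \<omega>)} \<in> events"
    and "prob {\<omega> \<in> space M. c \<le> scalar_prod (E \<omega>) (proj F *\<^sub>v E \<omega>)} \<le> v * real p / c"
    and "{\<omega> \<in> space M. c \<le> \<bar>scalar_prod \<mu> (E \<omega>)\<bar>} \<in> events"
    and "prob {\<omega> \<in> space M. c \<le> \<bar>scalar_prod \<mu> (E \<omega>)\<bar>} \<le> v * sqnorm \<mu> / c\<^sup>2"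
    and "{\<omega> \<in> space M. c \<le> sqnorm (E \<omega>)} \<in> events"
    and "prob {\<omega> \<in> space M. c \<le> sqnorm (E \<omega>)} \<le> v * real n / c"
proof -
  interpret orth_proj "proj F" n using orth_proj_proj[OF F] by simp
  have E: "E \<omega> \<in> carrier_vec n" for \<omega> by (simp add: E_def)
  have q: "scalar_prod (E \<omega>) (proj F *\<^sub>v E \<omega>)
      = (\<Sum>i<n. \<Sum>j<n. proj F $$ (i, j) * (\<epsilon> i \<omega> * \<epsilon> j \<omega>))" for \<omega>
    using carrier_matD[OF carrier]
    by (simp add: E_def scalar_prod_lessThan sum_distrib_left mult.left_commute)
  have q0: "0 \<le> scalar_prod (E \<omega>) (proj F *\<^sub>v E \<omega>)" for \<omega>
    using sqnorm_apply[OF E] sqnorm_nonneg[of "proj F *\<^sub>v E \<omega>"] by simp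
  show "{\<omega> \<in> space M. c \<le> scalar_prod (E \<omega>) (proj F *\<^sub>v E \<omega>)} \<in> events"
    "prob {\<omega> \<in> space M. c \<le> scalar_prod (E \<omega>) (proj F *\<^sub>v E \<omega>)} \<le> v * real p / c"
    using quadratic_form_Markov[OF err q q0 c] trace_proj[OF F] by simp_all
  have l: "(scalar_prod \<mu> (E \<omega>))\<^sup>2
      = (\<Sum>i<n. \<Sum>j<n. (\<mu> $ i * \<mu> $ j) * (\<epsilon> i \<omega> * \<epsilon> j \<omega>))" for \<omega>
    by (simp add: E_def scalar_prod_lessThan power2_eq_square sum_product mult.commute mult.left_commute)
  have "c \<le> \<bar>x\<bar> \<longleftrightarrow> c\<^sup>2 \<le> x\<^sup>2" for x using c abs_le_square_iff[of c x] by simp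
  then show "{\<omega> \<in> space M. c \<le> \<bar>scalar_prod \<mu> (E \<omega>)\<bar>} \<in> events"
    "prob {\<omega> \<in> space M. c \<le> \<bar>scalar_prod \<mu> (E \<omega>)\<bar>} \<le> v * sqnorm \<mu> / c\<^sup>2"
    using quadratic_form_Markov[OF err l _ zero_less_power[OF c, of 2]] carrier_vecD[OF \<mu>]
    by (simp_all add: sqnorm_eq_sum power2_eq_square)
  have s: "sqnorm (E \<omega>) = (\<Sum>i<n. \<Sum>j<n. (if i = j then 1 else 0) * (\<epsilon> i \<omega> * \<epsilon> j \<omega>))" for \<omega>
    by (simp add: E_def sqnorm_eq_sum power2_eq_square if_distrib[of "\<lambda>x. x * _"] cong: if_cong)
  show "{\<omega> \<in> space M. c \<le> sqnorm (E \<omega>)} \<in> events"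
    "prob {\<omega> \<in> space M. c \<le> sqnorm (E \<omega>)} \<le> v * real n / c"
    using quadratic_form_Markov[OF err s sqnorm_nonneg c] by simp_all
qed

text \<open>The ratio event need not be measurable; it is contained in the union of four measurable
  events.\<close>
lemma prob_loss_ratio_le:
  fixes \<epsilon> :: "nat \<Rightarrow> 'a \<Rightarrow> real" and n p k r :: nat and \<mu> :: "real vec"
  defines "y \<equiv> obs \<mu> \<epsilon>"
  assumes err: "indep_vars (\<lambda>_. borel) \<epsilon> {..<n}"
      "\<And>j. j < n \<Longrightarrow> integrable M (\<epsilon> j)"
      "\<And>j. j < n \<Longrightarrow> expectation (\<epsilon> j) = 0"
      "\<And>j. j < n \<Longrightarrow> integrable M (\<lambda>\<omega>. (\<epsilon> j \<omega>)\<^sup>2)"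
      "\<And>j. j < n \<Longrightarrow> variance (\<epsilon> j) = v"
    and X: "X \<in> carrier_mat n p" and \<mu>: "\<mu> \<in> carrier_vec n"
    and k: "k < n" and r: "1 \<le> r" and T: "\<And>i. i < r \<Longrightarrow> T i \<subseteq> {..<n}"
    and \<A>: "\<And>\<gamma>. \<gamma> \<in> \<A> \<Longrightarrow> \<gamma> \<subseteq> {..<p}"
    and det: "\<And>i \<gamma>. i < r \<Longrightarrow> \<gamma> \<in> insert {..<p} \<A> \<Longrightarrow> det (gram (submatrix X (T i) \<gamma>)) \<noteq> 0"
    and C: "sqnorm \<mu> \<le> C * real n" "0 \<le> C" and K: "1 \<le> K" and \<eta>: "0 < \<eta>"
    and \<delta>: "0 < \<delta>" "\<And>\<gamma>. \<gamma> \<in> \<A> \<Longrightarrow> \<delta> \<le> Delta X \<mu> \<gamma>"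
    and \<tau>: "\<tau> = 3 * \<eta> + 2 * sqrt (\<eta> * C)" "\<tau> < \<delta>"
    and t: "\<And>\<gamma>. \<gamma> \<in> \<A> \<Longrightarrow> \<bar>1 / (real n * real r) * (\<Sum>i<r. a_coef X k T i \<gamma>)\<bar> \<le> t"
    and \<rho>: "real (n - k) / real n * ln (2 * (C + K) * real n)
        + 2 * (t + real p * ln (real n / real (n - k)) / real n) \<le> \<rho>"
    and small: "(exp \<rho> - 1) * (C + K + \<tau>) + 2 * \<tau> + \<eta> \<le> \<kappa> * \<delta>"
    and V: "V \<in> events"
      "\<And>\<omega> i. \<omega> \<in> V \<Longrightarrow> i < r \<Longrightarrow> 0 < rss (submatrix X (T i) {..<p}) (subvec (y \<omega>) (T i))"
      "\<And>\<omega>. \<omega> \<in> V \<Longrightarrow> 0 < (\<Sum>i<r. ln (rss (submatrix X (T i) {..<p}) (subvec (y \<omega>) (T i))))"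
    and ahat: "\<And>\<omega>. \<omega> \<in> space M \<Longrightarrow>
      is_arg_min (Gamma_crit X k r T (y \<omega>)) (\<lambda>\<gamma>. \<gamma> \<in> \<A>) (ahat \<omega>)"
    and aL: "\<And>\<omega>. \<omega> \<in> space M \<Longrightarrow> is_arg_min (loss X \<mu> (y \<omega>)) (\<lambda>\<gamma>. \<gamma> \<in> \<A>) (aL \<omega>)"
  shows "prob {\<omega> \<in> space M. \<kappa> < \<bar>loss X \<mu> (y \<omega>) (ahat \<omega>) / loss X \<mu> (y \<omega>) (aL \<omega>) - 1\<bar>}
    \<le> v / \<eta> * (real p / real n) + v * C / \<eta>\<^sup>2 * (1 / real n) + v / K + (1 - prob V)"
proof -
  let ?F = "submatrix X UNIV {..<p}"
  let ?E = "\<lambda>\<omega>. Matrix.vec n (\<lambda>j. \<epsilon> j \<omega>)"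
  have n: "0 < n" using k by simp
  have r0: "0 < r" using r by simp
  have F: "?F \<in> carrier_mat n p" "det (gram ?F) \<noteq> 0"
    using nonsingular_designD[OF X T[OF r0] subset_refl det[OF r0]] by simp_all
  have c: "0 < \<eta> * real n" "0 < K * real n" using \<eta> K n by simp_all
  let ?B1 = "{\<omega> \<in> space M. \<eta> * real n \<le> scalar_prod (?E \<omega>) (proj ?F *\<^sub>v ?E \<omega>)}"
  let ?B2 = "{\<omega> \<in> space M. \<eta> * real n \<le> \<bar>scalar_prod \<mu> (?E \<omega>)\<bar>}"
  let ?B3 = "{\<omega> \<in> space M. K * real n \<le> sqnorm (?E \<omega>)}"
  note B12 = error_events(1-4)[OF err F \<mu> c(1)] and B3 = error_events(5,6)[OF err F \<mu> c(2)]
  have W: "space M - V \<in> events" using V(1) by simp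
  have v: "0 \<le> v"
    using err(5)[OF n] variance_positive[of "\<epsilon> 0"] by simp
  have "{\<omega> \<in> space M. \<kappa> < \<bar>loss X \<mu> (y \<omega>) (ahat \<omega>) / loss X \<mu> (y \<omega>) (aL \<omega>) - 1\<bar>}
      \<subseteq> ?B1 \<union> ?B2 \<union> ?B3 \<union> (space M - V)"
  \<comment> \<open>Pointwise: outside the four events all hypotheses of
    \<open>loss_le_of_Gamma_le\<close> hold, which confines the ratio to [1, 1 + \<kappa>].\<close>
  proof (rule subsetI, rule ccontr)
    fix \<omega>
    assume bad: "\<omega> \<in> {\<omega> \<in> space M. \<kappa> < \<bar>loss X \<mu> (y \<omega>) (ahat \<omega>) / loss X \<mu> (y \<omega>) (aL \<omega>) - 1\<bar>}"
      and good: "\<omega> \<notin> ?B1 \<union> ?B2 \<union> ?B3 \<union> (space M - V)"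
    from bad have \<omega>: "\<omega> \<in> space M" by simp
    with good have "\<omega> \<in> V"
      and b: "scalar_prod (?E \<omega>) (proj ?F *\<^sub>v ?E \<omega>) \<le> \<eta> * real n"
        "\<bar>scalar_prod \<mu> (?E \<omega>)\<bar> \<le> \<eta> * real n" "sqnorm (?E \<omega>) \<le> K * real n"
      by auto
    have y: "y \<omega> = \<mu> + ?E \<omega>" using \<mu> by (simp add: y_def obs_def)
    have E: "?E \<omega> \<in> carrier_vec n" by simp
    have mem: "ahat \<omega> \<in> \<A>" "aL \<omega> \<in> \<A>"
      and Gamma: "Gamma_crit X k r T (y \<omega>) (ahat \<omega>) \<le> Gamma_crit X k r T (y \<omega>) (aL \<omega>)"
      and minL: "loss X \<mu> (y \<omega>) (aL \<omega>) \<le> loss X \<mu> (y \<omega>) (ahat \<omega>)"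
      using ahat[OF \<omega>] aL[OF \<omega>] by (auto simp: is_arg_min_def not_less)
    have det': "det (gram (submatrix X (T i) \<gamma>)) \<noteq> 0"
      if "i < r" "\<gamma> \<in> {{..<p}, ahat \<omega>, aL \<omega>}" for i \<gamma> using det that mem by auto
    have t': "\<bar>1 / (real n * real r) * (\<Sum>i<r. a_coef X k T i \<gamma>)\<bar> \<le> t"
      if "\<gamma> \<in> {ahat \<omega>, aL \<omega>}" for \<gamma> using t that mem by blast
    note bounds = loss_le_of_Gamma_le[OF X \<mu> E k r T \<A>[OF mem(1)] \<A>[OF mem(2)] det' b K C
        V(2)[OF \<open>\<omega> \<in> V\<close>, unfolded y] less_imp_le[OF V(3)[OF \<open>\<omega> \<in> V\<close>, unfolded y]]
        \<delta>(2)[OF mem(1)] \<delta>(2)[OF mem(2)] \<tau> t' \<rho> Gamma[unfolded y], folded y]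
    have pos: "0 < loss X \<mu> (y \<omega>) (aL \<omega>)" using bounds(2) \<delta>(1) by simp
    \<comment> \<open>Since \<delta> bounds the minimal loss from below, an absolute excess of at
      most \<kappa>\<delta> is a relative excess of at most \<kappa>.\<close>
    have "\<kappa> * \<delta> \<le> \<kappa> * loss X \<mu> (y \<omega>) (aL \<omega>)" if "0 \<le> \<kappa>"
      using bounds(2) that by (intro mult_left_mono) auto
    \<comment> \<open>By minimality of the loss at \<open>aL\<close> the excess is nonnegative, and
      it is at most \<kappa>\<delta>.\<close>
    moreover have "0 \<le> \<kappa>"
    proof -
      have "0 \<le> \<kappa> * \<delta>" using bounds(1) minL small by linarith
      then show ?thesis using \<delta>(1) by (simp add: zero_le_mult_iff)
    qed
    ultimately have "loss X \<mu> (y \<omega>) (ahat \<omega>) \<le> (1 + \<kappa>) * loss X \<mu> (y \<omega>) (aL \<omega>)"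
      using bounds(1) small by (simp add: distrib_right)
    then have "loss X \<mu> (y \<omega>) (ahat \<omega>) / loss X \<mu> (y \<omega>) (aL \<omega>) \<le> 1 + \<kappa>"
      using pos by (simp add: pos_divide_le_eq)
    moreover have "1 \<le> loss X \<mu> (y \<omega>) (ahat \<omega>) / loss X \<mu> (y \<omega>) (aL \<omega>)"
      using pos minL by simp
    ultimately show False using bad by simp
  qed
  then have "prob {\<omega> \<in> space M. \<kappa> < \<bar>loss X \<mu> (y \<omega>) (ahat \<omega>) / loss X \<mu> (y \<omega>) (aL \<omega>) - 1\<bar>}
      \<le> prob (?B1 \<union> ?B2 \<union> ?B3 \<union> (space M - V))"
    using sets.Un[OF sets.Un[OF sets.Un[OF B12(1,3)] B3(1)] W] by (rule finite_measure_mono)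
  also have "\<dots> \<le> prob ?B1 + prob ?B2 + prob ?B3 + prob (space M - V)"
    using measure_Un_le[OF sets.Un[OF sets.Un[OF B12(1,3)] B3(1)] W]
      measure_Un_le[OF sets.Un[OF B12(1,3)] B3(1)] measure_Un_le[OF B12(1,3)] by linarith
  also have "\<dots> \<le> v * real p / (\<eta> * real n) + v * sqnorm \<mu> / (\<eta> * real n)\<^sup>2
      + v * real n / (K * real n) + (1 - prob V)"
    using B12(2,4) B3(2) prob_compl[OF V(1)] by simp
  also have "\<dots> \<le> v * real p / (\<eta> * real n) + v * (C * real n) / (\<eta> * real n)\<^sup>2
      + v * real n / (K * real n) + (1 - prob V)"
    using v C by (intro add_mono order_refl divide_right_mono mult_left_mono) auto
  also have "\<dots> = v / \<eta> * (real p / real n) + v * C / \<eta>\<^sup>2 * (1 / real n) + v / K + (1 - prob V)"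
    using n by (simp add: power2_eq_square)
  finally show ?thesis .
qed

end

section \<open>Asymptotics\<close>

text \<open>Both expressions are continuous in \<eta> and vanish at 0, so every sufficiently small
  positive \<eta> works.\<close>

lemma exists_small_remainder:
  fixes C \<delta> c :: real
  assumes "0 < \<delta>" "0 < c"
  shows "\<exists>\<eta>>0. 3 * \<eta> + 2 * sqrt (\<eta> * C) < \<delta> \<and> 2 * (3 * \<eta> + 2 * sqrt (\<eta> * C)) + \<eta> < c"
proof -
  have "((\<lambda>\<eta>. 3 * \<eta> + 2 * sqrt (\<eta> * C)) \<longlongrightarrow> 3 * 0 + 2 * sqrt (0 * C)) (at_right 0)"
    "((\<lambda>\<eta>. 2 * (3 * \<eta> + 2 * sqrt (\<eta> * C)) + \<eta>) \<longlongrightarrow> 2 * (3 * 0 + 2 * sqrt (0 * C)) + 0) (at_right 0)"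
    by (intro tendsto_intros)+
  then have "\<forall>\<^sub>F \<eta> in at_right 0. 3 * \<eta> + 2 * sqrt (\<eta> * C) < \<delta>"
    "\<forall>\<^sub>F \<eta> in at_right 0. 2 * (3 * \<eta> + 2 * sqrt (\<eta> * C)) + \<eta> < c"
    using assms by (auto dest: order_tendstoD(2))
  then have "\<forall>\<^sub>F \<eta> in at_right 0. 0 < \<eta> \<and> 3 * \<eta> + 2 * sqrt (\<eta> * C) < \<delta>
      \<and> 2 * (3 * \<eta> + 2 * sqrt (\<eta> * C)) + \<eta> < c"
    using eventually_at_right_less[of "0::real"] by eventually_elim simp
  then show ?thesis using eventually_happens' trivial_limit_at_right_real by blast
qed

text \<open>Eventually |x| \<le> |x L|. It is applied with L = ln n to the training fraction and
  with L = \<lambda> to p / n.\<close>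

lemma tendsto_zero_of_mult_log:
  fixes x :: "nat \<Rightarrow> real"
  assumes "(\<lambda>n. x n * L n) \<longlonglongrightarrow> 0" and "\<forall>\<^sub>F n in sequentially. 1 \<le> L n"
  shows "x \<longlonglongrightarrow> 0"
proof (rule Lim_null_comparison[OF _ tendsto_rabs_zero[OF assms(1)]])
  show "\<forall>\<^sub>F n in sequentially. norm (x n) \<le> \<bar>x n * L n\<bar>"
    using assms(2)
  proof eventually_elim
    case (elim n)
    then show ?case using mult_left_mono[of 1 "L n" "\<bar>x n\<bar>"] by (simp add: abs_mult)
  qed
qed

theorem theorem3p1:
  fixes M :: "nat \<Rightarrow> 'a measure"
    and e :: "nat \<Rightarrow> nat \<Rightarrow> 'a \<Rightarrow> real"
    and \<sigma>2 :: real
    and \<mu> :: "nat \<Rightarrow> real vec"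
    and X :: "nat \<Rightarrow> real mat"
    and p k r :: "nat \<Rightarrow> nat"
    and \<A> :: "nat \<Rightarrow> nat set set"
    and T :: "nat \<Rightarrow> nat \<Rightarrow> nat set"
    and \<alpha>hat \<alpha>L :: "nat \<Rightarrow> 'a \<Rightarrow> nat set"
    and lam :: "nat \<Rightarrow> real"
    and m N :: nat
  defines "lam \<equiv> \<lambda>n. ln (real n / real (n - k n))"
  \<comment> \<open>data\<close>
  assumes "\<And>n. n \<ge> N \<Longrightarrow> prob_space (M n)"
    and "\<And>n. n \<ge> N \<Longrightarrow> prob_space.indep_vars (M n) (\<lambda>_. borel) (e n) {..<n}"
    and "\<And>n j. n \<ge> N \<Longrightarrow> j < n \<Longrightarrow> integrable (M n) (e n j)"
    and "\<And>n j. n \<ge> N \<Longrightarrow> j < n \<Longrightarrow> prob_space.expectation (M n) (e n j) = 0"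
    and "\<And>n j. n \<ge> N \<Longrightarrow> j < n \<Longrightarrow> integrable (M n) (\<lambda>\<omega>. (e n j \<omega>)\<^sup>2)"
    and "\<And>n j. n \<ge> N \<Longrightarrow> j < n \<Longrightarrow> prob_space.variance (M n) (e n j) = \<sigma>2"
    and "\<And>n. n \<ge> N \<Longrightarrow> \<mu> n \<in> carrier_vec n"
    and "\<And>n. n \<ge> N \<Longrightarrow> X n \<in> carrier_mat n (p n)"
  \<comment> \<open>models\<close>
    and "\<And>n. n \<ge> N \<Longrightarrow> \<A> n \<noteq> {}"
    and "\<And>n \<alpha>. n \<ge> N \<Longrightarrow> \<alpha> \<in> \<A> n \<Longrightarrow> \<alpha> \<noteq> {} \<and> \<alpha> \<subseteq> {..<p n}"
    and "\<And>n \<alpha>. n \<ge> N \<Longrightarrow> \<alpha> \<in> \<A> n \<Longrightarrow>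
           \<mu> n \<notin> vec_space.col_space n (submatrix (X n) UNIV \<alpha>)"
  \<comment> \<open>training samples\<close>
    and "\<And>n. n \<ge> N \<Longrightarrow> 1 \<le> k n \<and> k n < n"
    and "filterlim (\<lambda>n. n - k n) at_top sequentially"
    and "\<And>n. n \<ge> N \<Longrightarrow> 1 \<le> r n"
    and "\<And>n i. n \<ge> N \<Longrightarrow> i < r n \<Longrightarrow> T n i \<subseteq> {..<n} \<and> card (T n i) = n - k n"
    and "\<And>n. n \<ge> N \<Longrightarrow> \<exists>c. \<forall>j<n. card {i. i < r n \<and> j \<in> T n i} = c"
    and "\<And>n i \<alpha>. n \<ge> N \<Longrightarrow> i < r n \<Longrightarrow> \<alpha> \<in> insert {..<p n} (\<A> n) \<Longrightarrow>
           invertible_mat (gram (submatrix (X n) (T n i) \<alpha>))"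
  \<comment> \<open>(i)\<close>
    and "m > 0"
    and "\<And>n. n \<ge> N \<Longrightarrow> integrable (M n) (\<lambda>\<omega>. (e n 0 \<omega>) ^ (4 * m))"
    and "(\<lambda>n. \<Sum>\<alpha>\<in>\<A> n. 1 / (nrisk (M n) (e n) (X n) (\<mu> n) \<alpha>) ^ m) \<longlonglongrightarrow> 0"
    and "(\<lambda>n. real (p n) * lam n / Min (nrisk (M n) (e n) (X n) (\<mu> n) ` \<A> n)) \<longlonglongrightarrow> 0"
    and "(\<lambda>n. Max ((\<lambda>\<alpha>. (1 / real (r n) * (\<Sum>i<r n. a_coef (X n) (k n) (T n) i \<alpha>))
                  / nrisk (M n) (e n) (X n) (\<mu> n) \<alpha>) ` \<A> n)) \<longlonglongrightarrow> 0"
  \<comment> \<open>(ii)\<close>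
    and "liminf (\<lambda>n. ereal (Min (Delta (X n) (\<mu> n) ` \<A> n))) > 0"
  \<comment> \<open>(iii)\<close>
    and "(\<lambda>n. real (n - k n) / real n * ln (real n)) \<longlonglongrightarrow> 0"
    and "(\<lambda>n. real (p n) * lam n / real n) \<longlonglongrightarrow> 0"
    and "\<exists>C. \<forall>n\<ge>N. 1 / real n * (\<Sum>j<n. (\<mu> n $ j)\<^sup>2) \<le> C"
  \<comment> \<open>(iv), uniformly over the candidate models\<close>
    and "(\<lambda>n. Max ((\<lambda>\<alpha>. \<bar>1 / (real n * real (r n))
                    * (\<Sum>i<r n. a_coef (X n) (k n) (T n) i \<alpha>)\<bar>) ` \<A> n)) \<longlonglongrightarrow> 0"
  \<comment> \<open>(v); as ln 0 = 0 here, positivity of the residual sums of squares is part of the event\<close>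
    and "(\<lambda>n. measure (M n) {\<omega> \<in> space (M n).
            (\<forall>i<r n. 0 < rss (submatrix (X n) (T n i) {..<p n})
                            (subvec (obs (\<mu> n) (e n) \<omega>) (T n i))) \<and>
            0 < (\<Sum>i<r n. ln (rss (submatrix (X n) (T n i) {..<p n})
                            (subvec (obs (\<mu> n) (e n) \<omega>) (T n i))))}) \<longlonglongrightarrow> 1"
  \<comment> \<open>minimizers; the minimal loss is measurable whatever selection \<open>\<alpha>L\<close> is used\<close>
    and "\<And>n. n \<ge> N \<Longrightarrow> \<alpha>hat n \<in> measurable (M n) (count_space (\<A> n))"
    and "\<And>n \<omega>. n \<ge> N \<Longrightarrow> \<omega> \<in> space (M n) \<Longrightarrow>
           is_arg_min (Gamma_crit (X n) (k n) (r n) (T n) (obs (\<mu> n) (e n) \<omega>))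
             (\<lambda>\<alpha>. \<alpha> \<in> \<A> n) (\<alpha>hat n \<omega>)"
    and "\<And>n \<omega>. n \<ge> N \<Longrightarrow> \<omega> \<in> space (M n) \<Longrightarrow>
           is_arg_min (loss (X n) (\<mu> n) (obs (\<mu> n) (e n) \<omega>)) (\<lambda>\<alpha>. \<alpha> \<in> \<A> n) (\<alpha>L n \<omega>)"
  shows "tendsto_in_prob M
           (\<lambda>n \<omega>. loss (X n) (\<mu> n) (obs (\<mu> n) (e n) \<omega>) (\<alpha>hat n \<omega>)
                  / loss (X n) (\<mu> n) (obs (\<mu> n) (e n) \<omega>) (\<alpha>L n \<omega>)) 1"
proof -
  note prob = assms(2) and indep = assms(3) and int1 = assms(4) and mean = assms(5)
    and int2 = assms(6) and var = assms(7) and \<mu> = assms(8) and X = assms(9)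
    and \<A>_ne = assms(10) and \<A>_sub = assms(11) and k = assms(13) and r = assms(15)
    and T = assms(16) and inv = assms(18) and Delta_liminf = assms(24) and log_n = assms(25)
    and p_lam = assms(26) and \<mu>_bound = assms(27) and a_coef_lim = assms(28)
    and V_lim = assms(29) and ahat = assms(31) and aL = assms(32)
  have lam: "lam n = ln (real n / real (n - k n))" for n by (simp add: lam_def)
  have train_lim: "(\<lambda>n. real (n - k n) / real n) \<longlonglongrightarrow> 0"
  proof (rule tendsto_zero_of_mult_log[OF log_n])
    show "\<forall>\<^sub>F n in sequentially. 1 \<le> ln (real n)"
      using filterlim_compose[OF ln_at_top filterlim_real_sequentially]
      by (simp add: filterlim_at_top)
  qed
  \<comment> \<open>Once (n - k) / n drops below exp (-1), its negative logarithm \<lambda> exceeds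
    1.\<close>
  have lam_ge: "\<forall>\<^sub>F n in sequentially. 1 \<le> lam n"
    using order_tendstoD(2)[OF train_lim exp_gt_zero[of "- 1"]] eventually_ge_at_top[of N]
  proof eventually_elim
    case (elim n)
    then have "0 < real (n - k n) / real n" using k[of n] by auto
    then have "ln (real (n - k n) / real n) < ln (exp (- 1))"
      using ln_strict_mono[OF elim(1)] by blast
    then show ?case using k[OF elim(2)] by (simp add: lam ln_div)
  qed
  have p_lim: "(\<lambda>n. real (p n) / real n) \<longlonglongrightarrow> 0"
    using tendsto_zero_of_mult_log[OF _ lam_ge] p_lam by simp
  define t where "t n = Max ((\<lambda>\<alpha>. \<bar>1 / (real n * real (r n))
      * (\<Sum>i<r n. a_coef (X n) (k n) (T n) i \<alpha>)\<bar>) ` \<A> n)" for n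
  have t_lim: "t \<longlonglongrightarrow> 0" using a_coef_lim by (simp add: t_def[abs_def])
  obtain C where C: "0 \<le> C" "\<And>n. n \<ge> N \<Longrightarrow> sqnorm (\<mu> n) \<le> C * real n"
  proof -
    obtain C0 where C0: "\<And>n. n \<ge> N \<Longrightarrow> 1 / real n * (\<Sum>j<n. (\<mu> n $ j)\<^sup>2) \<le> C0"
      using \<mu>_bound by blast
    \<comment> \<open>The maximum with 0 supplies the sign of C that
      \<open>prob_loss_ratio_le\<close> asks for.\<close>
    have "sqnorm (\<mu> n) \<le> max 0 C0 * real n" if "n \<ge> N" for n
    proof -
      have "0 < n" using k[OF that] by simp
      then have "sqnorm (\<mu> n) \<le> C0 * real n"
        using C0[OF that] carrier_vecD[OF \<mu>[OF that]] by (simp add: sqnorm_eq_sum field_simps)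
      also have "\<dots> \<le> max 0 C0 * real n" by (intro mult_right_mono) auto
      finally show ?thesis .
    qed
    then show thesis using that[of "max 0 C0"] by simp
  qed
  obtain \<delta> where \<delta>: "0 < \<delta>" and Delta_ev: "\<forall>\<^sub>F n in sequentially. \<delta> < Min (Delta (X n) (\<mu> n) ` \<A> n)"
  proof -
    obtain \<delta> where "0 < ereal \<delta>" "ereal \<delta> < liminf (\<lambda>n. ereal (Min (Delta (X n) (\<mu> n) ` \<A> n)))"
      using ereal_dense2[OF Delta_liminf] by blast
    then show thesis using that[of \<delta>] less_LiminfD[of "ereal \<delta>" sequentially] by fastforce
  qed
  show ?thesis
    unfolding tendsto_in_prob_def
  proof (intro allI impI)
    fix \<kappa> :: real assume \<kappa>: "0 < \<kappa>"
    let ?bad = "\<lambda>n. measure (M n) {\<omega> \<in> space (M n).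
      \<kappa> < \<bar>loss (X n) (\<mu> n) (obs (\<mu> n) (e n) \<omega>) (\<alpha>hat n \<omega>)
        / loss (X n) (\<mu> n) (obs (\<mu> n) (e n) \<omega>) (\<alpha>L n \<omega>) - 1\<bar>}"
    have "\<forall>\<^sub>F n in sequentially. ?bad n < \<zeta>" if \<zeta>: "0 < \<zeta>" for \<zeta>
    proof -
      \<comment> \<open>The tail bound \<sigma>2 / K for ||e||^2 does not vanish as n grows, so K is
        chosen first to keep it below \<zeta>; then \<eta> is fixed, and only then n grows.\<close>
      define K where "K = max 1 (2 * \<sigma>2 / \<zeta>)"
      have K: "1 \<le> K" by (simp add: K_def)
      have K_bound: "\<sigma>2 / K < \<zeta>"
      proof -
        have "2 * \<sigma>2 / \<zeta> \<le> K" by (simp add: K_def)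
        then have "2 * \<sigma>2 \<le> \<zeta> * K" using \<zeta> by (simp add: field_simps)
        moreover have "0 < \<zeta> * K" using \<zeta> K by simp
        ultimately have "\<sigma>2 < \<zeta> * K" by linarith
        then show ?thesis using K by (simp add: pos_divide_less_eq)
      qed
      \<comment> \<open>Half of \<kappa>\<delta> is reserved for 2\<tau> + \<eta>, the other half
        for the term with exp \<rho> - 1.\<close>
      obtain \<eta> where \<eta>: "0 < \<eta>" "3 * \<eta> + 2 * sqrt (\<eta> * C) < \<delta>"
        "2 * (3 * \<eta> + 2 * sqrt (\<eta> * C)) + \<eta> < \<kappa> * \<delta> / 2"
        using exists_small_remainder[OF \<delta>, of "\<kappa> * \<delta> / 2" C] \<kappa> \<delta> by auto
      define \<tau> where "\<tau> = 3 * \<eta> + 2 * sqrt (\<eta> * C)"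
      define \<rho> where "\<rho> n = real (n - k n) / real n * ln (2 * (C + K) * real n)
        + 2 * (t n + real (p n) * ln (real n / real (n - k n)) / real n)" for n
      \<comment> \<open>The logarithm in \<open>\<rho>\<close> is split into a constant and ln n, so
        that each product tends to 0 separately.\<close>
      have "(\<lambda>n. real (n - k n) / real n * ln (2 * (C + K))
          + real (n - k n) / real n * ln (real n) + 2 * (t n + real (p n) * lam n / real n))
          \<longlonglongrightarrow> 0 * ln (2 * (C + K)) + 0 + 2 * (0 + 0)"
        by (intro tendsto_intros train_lim log_n t_lim p_lam)
      moreover have "\<forall>\<^sub>F n in sequentially. real (n - k n) / real n * ln (2 * (C + K))
          + real (n - k n) / real n * ln (real n) + 2 * (t n + real (p n) * lam n / real n) = \<rho> n"
        using eventually_gt_at_top[of 0]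
      proof eventually_elim
        case (elim n)
        have "ln (2 * (C + K) * real n) = ln (2 * (C + K)) + ln (real n)"
          using elim C(1) K by (intro ln_mult_pos) auto
        then show ?case by (simp only: \<rho>_def lam distrib_left)
      qed
      ultimately have \<rho>_lim: "\<rho> \<longlonglongrightarrow> 0"
        using Lim_transform_eventually by fastforce
      have "(\<lambda>n. (exp (\<rho> n) - 1) * (C + K + \<tau>)) \<longlonglongrightarrow> (exp 0 - 1) * (C + K + \<tau>)"
        by (intro tendsto_intros \<rho>_lim)
      then have \<rho>_ev: "\<forall>\<^sub>F n in sequentially. (exp (\<rho> n) - 1) * (C + K + \<tau>) < \<kappa> * \<delta> / 2"
        by (rule order_tendstoD(2)) (use \<kappa> \<delta> in simp)
      define V where "V n = {\<omega> \<in> space (M n).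
            (\<forall>i<r n. 0 < rss (submatrix (X n) (T n i) {..<p n})
                            (subvec (obs (\<mu> n) (e n) \<omega>) (T n i))) \<and>
            0 < (\<Sum>i<r n. ln (rss (submatrix (X n) (T n i) {..<p n})
                            (subvec (obs (\<mu> n) (e n) \<omega>) (T n i))))}" for n
      have V_lim': "(\<lambda>n. measure (M n) (V n)) \<longlonglongrightarrow> 1" using V_lim by (simp only: V_def)
      have "(\<lambda>n. \<sigma>2 / \<eta> * (real (p n) / real n) + \<sigma>2 * C / \<eta>\<^sup>2 * (1 / real n) + \<sigma>2 / K
          + (1 - measure (M n) (V n)))
          \<longlonglongrightarrow> \<sigma>2 / \<eta> * 0 + \<sigma>2 * C / \<eta>\<^sup>2 * 0 + \<sigma>2 / K + (1 - 1)"
        by (intro tendsto_intros p_lim V_lim' lim_1_over_n)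
      moreover have "\<sigma>2 / \<eta> * 0 + \<sigma>2 * C / \<eta>\<^sup>2 * 0 + \<sigma>2 / K + (1 - 1) < \<zeta>"
        using K_bound by simp
      ultimately have bound_ev: "\<forall>\<^sub>F n in sequentially. \<sigma>2 / \<eta> * (real (p n) / real n)
          + \<sigma>2 * C / \<eta>\<^sup>2 * (1 / real n) + \<sigma>2 / K + (1 - measure (M n) (V n)) < \<zeta>"
        by (rule order_tendstoD(2))
      \<comment> \<open>A set outside the sigma-algebra has measure 0 by convention; positive
        measure therefore certifies below that \<open>V n\<close> is an event.\<close>
      have V_ev: "\<forall>\<^sub>F n in sequentially. 0 < measure (M n) (V n)"
        using order_tendstoD(1)[OF V_lim'] by simp
      show ?thesis
        using eventually_ge_at_top[of N] Delta_ev \<rho>_ev bound_ev V_ev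
      proof eventually_elim
        case (elim n)
        note n = elim(1)
        interpret prob_space "M n" by (rule prob[OF n])
        have fin: "finite (\<A> n)"
          using \<A>_sub[OF n] by (intro finite_subset[of "\<A> n" "Pow {..<p n}"]) auto
        have Tn: "T n i \<subseteq> {..<n}" if "i < r n" for i using T[OF n that] by simp
        have kn: "k n < n" using k[OF n] by simp
        have sub: "\<gamma> \<subseteq> {..<p n}" if "\<gamma> \<in> \<A> n" for \<gamma> using \<A>_sub[OF n that] by simp
        have det: "det (gram (submatrix (X n) (T n i) \<gamma>)) \<noteq> 0"
          if "i < r n" "\<gamma> \<in> insert {..<p n} (\<A> n)" for i \<gamma>
          using det_nonzero_if_invertible_mat[OF gram_carrier inv[OF n that]]
            submatrix_carrier(2)[OF X[OF n] Tn[OF that(1)]] sub that(2) by blast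
        have Delta: "\<delta> \<le> Delta (X n) (\<mu> n) \<gamma>" if "\<gamma> \<in> \<A> n" for \<gamma>
          using less_le_trans[OF elim(2) Min_le[OF finite_imageI[OF fin] imageI[OF that]]] by simp
        have tn: "\<bar>1 / (real n * real (r n)) * (\<Sum>i<r n. a_coef (X n) (k n) (T n) i \<gamma>)\<bar> \<le> t n"
          if "\<gamma> \<in> \<A> n" for \<gamma>
          unfolding t_def using fin that by (intro Max_ge) auto
        have small: "(exp (\<rho> n) - 1) * (C + K + \<tau>) + 2 * \<tau> + \<eta> \<le> \<kappa> * \<delta>"
          using elim(3) \<eta>(3) by (simp add: \<tau>_def)
        have V: "V n \<in> events" using elim(5) measure_notin_sets[of "V n" "M n"] by fastforce
        have "?bad n \<le> \<sigma>2 / \<eta> * (real (p n) / real n) + \<sigma>2 * C / \<eta>\<^sup>2 * (1 / real n) + \<sigma>2 / K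
            + (1 - measure (M n) (V n))"
        proof (rule prob_loss_ratio_le[OF indep[OF n] int1[OF n] mean[OF n] int2[OF n] var[OF n]
              X[OF n] \<mu>[OF n] kn r[OF n] Tn sub det C(2)[OF n] C(1) K \<eta>(1) \<delta> Delta \<tau>_def _ tn _
              small V _ _ ahat[OF n] aL[OF n]])
          show "\<tau> < \<delta>" using \<eta>(2) by (simp add: \<tau>_def)
        qed (auto simp: \<rho>_def V_def)
        then show ?case using elim(4) by simp
      qed
    qed
    then show "?bad \<longlonglongrightarrow> 0"
    proof (intro order_tendstoI)
      fix a :: real assume "a < 0"
      then show "\<forall>\<^sub>F n in sequentially. a < ?bad n"
        by (intro always_eventually allI less_le_trans[OF _ measure_nonneg])
    qed blast
  qed
qed

end
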